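(* Equip $V$ with the $U^\vee_q$-module structure for which $x,X,A$ act as $K^{-1},B^{-1},\mathbf{A}$, respectively. Then this $U^\vee_q$-module $V$ extends to a $U_q(\mathfrak{sl}_2)$-module. On the $U_q(\mathfrak{sl}_2)$-module $V$ we have $\nu_z=a\psi$.
   Context: $\mathbb{F}$ is a field and $q\in\mathbb{F}$ is nonzero with $q^4\neq 1$. Tridiagonal pairs. Let $V$ be an $\mathbb{F}$-vector space of finite positive dimension. A tridiagonal pair on $V$ is an ordered pair of $\mathbb{F}$-linear maps $\mathbf{A},\mathbf{A}^*:V\to V$ such that: (i) each of $\mathbf{A},\mathbf{A}^*$ is diagonalizable; (ii) there is an ordering $\{V_i\}_{i=0}^d$ of the eigenspaces of $\mathbf{A}$ with $\mathbf{A}^*V_i\subseteq V_{i-1}+V_i+V_{i+1}$ for $0\le i\le d$ ($V_{-1}=V_{d+1}=0$); (iii) there is an ordering $\{V^*_i\}_{i=0}^\delta$ of the eigenspaces of $\mathbf{A}^*$ with $\mathbf{A}V^*_i\subseteq V^*_{i-1}+V^*_i+V^*_{i+1}$ for $0\le i\le\delta$ ($V^*_{-1}=V^*_{\delta+1}=0$); (iv) there is no subspace $W\subseteq V$ with $\mathbf{A}W\subseteq W$, $\mathbf{A}^*W\subseteq W$, $W\neq0$, $W\neq V$. It is known that $d=\delta$ (the diameter). Fix a tridiagonal pair $\mathbf{A},\mathbf{A}^*$ on $V$ with $d\ge1$, fix orderings $\{V_i\}_{i=0}^d$, $\{V^*_i\}_{i=0}^d$ satisfying (ii), (iii), and let $\theta_i,\theta^*_i$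 be the eigenvalues of $\mathbf{A},\mathbf{A}^*$ for $V_i,V^*_i$. Assume the pair has $q$-Racah type: there exist nonzero $a,b\in\mathbb{F}$ with $\theta_i=aq^{d-2i}+a^{-1}q^{2i-d}$ and $\theta^*_i=bq^{d-2i}+b^{-1}q^{2i-d}$ for $0\le i\le d$; fix these (then $a^2\neq1$). For $0\le i\le d$ let $$U_i=(V^*_0+\cdots+V^*_i)\cap(V_i+\cdots+V_d),\qquad U^\Downarrow_i=(V^*_0+\cdots+V^*_i)\cap(V_0+\cdots+V_{d-i}).$$ It is known that $V=\sum_{i=0}^dU_i$ and $V=\sum_{i=0}^dU^\Downarrow_i$ are direct sums. $K:V\to V$ (resp. $B:V\to V$) is the $\mathbb{F}$-linear map acting on $U_i$ (resp. $U^\Downarrow_i$) as $q^{d-2i}$ times the identity, for $0\le i\le d$; in particular $K,B$ are invertible. It is known that $aI-a^{-1}BK^{-1}$ is invertible. The (normalized) Bockting operator $\psi:V\to V$ is $$\psi=q^{-1}(I-BK^{-1})(aI-a^{-1}BK^{-1})^{-1}.$$ The algebra. $U_q(\mathfrak{sl}_2)$ is the $\mathbb{F}$-algebra with generators $x,y^{\pm1},z$ and relations $yy^{-1}=y^{-1}y=1$, $\frac{qxy-q^{-1}yx}{q-q^{-1}}=\frac{qyz-q^{-1}zy}{q-q^{-1}}=\frac{qzx-q^{-1}xz}{q-q^{-1}}=1$. $U^\vee_q$ is its (unital) subalgebra generated by $x,y^{-1},z$. With $a\in\mathbb{F}$ the fixed nonzero scalar satisfying $\theta_i=aq^{d-2i}+a^{-1}q^{2i-d}$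 for $0\le i\le d$, set $X=a^{-2}x+(1-a^{-2})y^{-1}$, $Z=a^2z+(1-a^2)y^{-1}$, $A=a^{-1}x+az=aX+a^{-1}Z$. The element $\nu_z\in U_q(\mathfrak{sl}_2)$ is $\nu_z=q(1-xy)=q^{-1}(1-yx)$. The algebra $U^\vee_q$ is generated by $x,X,A$, and there is a $U^\vee_q$-module structure on $V$ for which $x,X,A$ act as $K^{-1},B^{-1},\mathbf{A}$. *)

theory Defs
  imports
    "HOL-Library.Poly_Mapping"
    "HOL-Algebra.QuotRing"
    "HOL-Algebra.Generated_Rings"
begin

section \<open>Tridiagonal pairs\<close>

definition eigenspace :: "('f::field \<Rightarrow> 'v::ab_group_add \<Rightarrow> 'v) \<Rightarrow> ('v \<Rightarrow> 'v) \<Rightarrow> 'f \<Rightarrow> 'v set" where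
  "eigenspace scale f \<theta> = {v. f v = scale \<theta> v}"

definition eigenspaces :: "('f::field \<Rightarrow> 'v::ab_group_add \<Rightarrow> 'v) \<Rightarrow> ('v \<Rightarrow> 'v) \<Rightarrow> 'v set set" where
  "eigenspaces scale f = {E. \<exists>\<theta>. E = eigenspace scale f \<theta> \<and> E \<noteq> {0}}"

text \<open>The sum of a family of subspaces is the span of their union; an empty sum is the zero
  subspace.\<close>

definition subspace_sum :: "('f::field \<Rightarrow> 'v::ab_group_add \<Rightarrow> 'v) \<Rightarrow> (nat \<Rightarrow> 'v set) \<Rightarrow> nat set \<Rightarrow> 'v set" where
  "subspace_sum scale W I = Modules.module.span scale (\<Union>i\<in>I. W i)"

definition diagonalizable :: "('f::field \<Rightarrow> 'v::ab_group_add \<Rightarrow> 'v) \<Rightarrow> ('v \<Rightarrow> 'v) \<Rightarrow> bool" where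
  "diagonalizable scale f \<longleftrightarrow> Modules.module.span scale (\<Union> (eigenspaces scale f)) = UNIV"

text \<open>\<open>W 0, \<dots>, W d\<close> lists the eigenspaces of \<open>f\<close> without repetition, and \<open>g\<close> acts on them in a block
  tridiagonal fashion.  The index set \<open>{j. j \<le> d \<and> j \<le> i + 1 \<and> i \<le> j + 1}\<close> is
  \<open>{i - 1, i, i + 1} \<inter> {0, \<dots>, d}\<close>, which accounts for the convention \<open>W (-1) = W (d + 1) = 0\<close>.\<close>

definition tridiagonal_ordering ::
  "('f::field \<Rightarrow> 'v::ab_group_add \<Rightarrow> 'v) \<Rightarrow> ('v \<Rightarrow> 'v) \<Rightarrow> ('v \<Rightarrow> 'v) \<Rightarrow> nat \<Rightarrow> (nat \<Rightarrow> 'v set) \<Rightarrow> bool" where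
  "tridiagonal_ordering scale f g d W \<longleftrightarrow>
     bij_betw W {0..d} (eigenspaces scale f) \<and>
     (\<forall>i\<le>d. g ` W i \<subseteq> subspace_sum scale W {j. j \<le> d \<and> j \<le> i + 1 \<and> i \<le> j + 1})"

definition tridiagonal_pair ::
  "('f::field \<Rightarrow> 'v::ab_group_add \<Rightarrow> 'v) \<Rightarrow> ('v \<Rightarrow> 'v) \<Rightarrow> ('v \<Rightarrow> 'v) \<Rightarrow> bool" where
  "tridiagonal_pair scale A As \<longleftrightarrow>
     (\<exists>Basis. finite_dimensional_vector_space scale Basis) \<and>
     vector_space.dim scale (UNIV :: 'v set) > 0 \<and>
     Vector_Spaces.linear scale scale A \<and> Vector_Spaces.linear scale scale As \<and>
     diagonalizable scale A \<and> diagonalizable scale As \<and>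
     (\<exists>d V. tridiagonal_ordering scale A As d V) \<and>
     (\<exists>\<delta> Vs. tridiagonal_ordering scale As A \<delta> Vs) \<and>
     \<not> (\<exists>W. Modules.module.subspace scale W \<and> A ` W \<subseteq> W \<and> As ` W \<subseteq> W \<and> W \<noteq> {0} \<and> W \<noteq> UNIV)"

definition split_U ::
  "('f::field \<Rightarrow> 'v::ab_group_add \<Rightarrow> 'v) \<Rightarrow> nat \<Rightarrow> (nat \<Rightarrow> 'v set) \<Rightarrow> (nat \<Rightarrow> 'v set) \<Rightarrow> nat \<Rightarrow> 'v set" where
  "split_U scale d V Vs i = subspace_sum scale Vs {0..i} \<inter> subspace_sum scale V {i..d}"

definition split_U_down ::
  "('f::field \<Rightarrow> 'v::ab_group_add \<Rightarrow> 'v) \<Rightarrow> nat \<Rightarrow> (nat \<Rightarrow> 'v set) \<Rightarrow> (nat \<Rightarrow> 'v set) \<Rightarrow> nat \<Rightarrow> 'v set" where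
  "split_U_down scale d V Vs i = subspace_sum scale Vs {0..i} \<inter> subspace_sum scale V {0..d - i}"

text \<open>The normalized Bockting operator \<open>q\<^sup>-\<^sup>1 (I - B K\<^sup>-\<^sup>1) (a I - a\<^sup>-\<^sup>1 B K\<^sup>-\<^sup>1)\<^sup>-\<^sup>1\<close>.  Inverse maps are
  written \<open>inv_into UNIV\<close>, since HOL-Algebra overloads the notation \<open>inv\<close>.\<close>

definition bockting ::
  "('f::field \<Rightarrow> 'v::ab_group_add \<Rightarrow> 'v) \<Rightarrow> 'f \<Rightarrow> 'f \<Rightarrow> ('v \<Rightarrow> 'v) \<Rightarrow> ('v \<Rightarrow> 'v) \<Rightarrow> 'v \<Rightarrow> 'v" where
  "bockting scale q a K B =
     (let T = B \<circ> inv_into UNIV K in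
      (\<lambda>v. scale (inverse q) v) \<circ> (\<lambda>v. v - T v) \<circ>
        inv_into UNIV (\<lambda>v. scale a v - scale (inverse a) (T v)))"


section \<open>The free algebra on four generators\<close>

datatype uq_gen = Gx | Gy | Gyi | Gz

text \<open>Words in the generators form a monoid under concatenation, written additively because
  \<open>poly_mapping\<close> takes its convolution product with respect to addition of the keys.  Hence
  \<open>uq_word \<Rightarrow>\<^sub>0 'f\<close> is the free associative unital algebra on the generators; the scalar
  \<open>c\<close> is the element \<open>Poly_Mapping.single 0 c\<close>.\<close>

datatype uq_word = Word (letters: "uq_gen list")

instantiation uq_word :: monoid_add
begin

definition zero_uq_word :: uq_word where
  "zero_uq_word = Word []"

definition plus_uq_word :: "uq_word \<Rightarrow> uq_word \<Rightarrow> uq_word" where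
  "plus_uq_word u w = Word (letters u @ letters w)"

instance
  by standard (simp_all add: zero_uq_word_def plus_uq_word_def)

end

type_synonym 'f free_alg = "uq_word \<Rightarrow>\<^sub>0 'f"

definition fscalar :: "'f::field \<Rightarrow> 'f free_alg" where
  "fscalar c = Poly_Mapping.single 0 c"

definition fgen :: "uq_gen \<Rightarrow> ('f::field) free_alg" where
  "fgen g = Poly_Mapping.single (Word [g]) 1"

definition free_ring :: "('f::field) free_alg ring" where
  "free_ring = \<lparr>carrier = UNIV, monoid.mult = (*), one = 1, ring.zero = 0, add = (+)\<rparr>"

lemma ring_free_ring: "ring (free_ring :: ('f::field) free_alg ring)"
  by unfold_locales
    (auto simp: free_ring_def algebra_simps Units_def intro!: exI[of _ "- _"] right_minus left_minus)


section \<open>The algebra \<open>U\<^sub>q(sl\<^sub>2)\<close> in its equitable presentation\<close>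

text \<open>\<open>(q u v - q\<^sup>-\<^sup>1 v u) / (q - q\<^sup>-\<^sup>1) - 1\<close>\<close>

definition q_weyl :: "'f::field \<Rightarrow> uq_gen \<Rightarrow> uq_gen \<Rightarrow> 'f free_alg" where
  "q_weyl q u v =
     fscalar (inverse (q - inverse q)) *
       (fscalar q * fgen u * fgen v - fscalar (inverse q) * fgen v * fgen u) - 1"

definition uq_relators :: "'f::field \<Rightarrow> 'f free_alg set" where
  "uq_relators q =
     {fgen Gy * fgen Gyi - 1, fgen Gyi * fgen Gy - 1, q_weyl q Gx Gy, q_weyl q Gy Gz, q_weyl q Gz Gx}"

definition uq_ideal :: "'f::field \<Rightarrow> 'f free_alg set" where
  "uq_ideal q = Idl\<^bsub>free_ring\<^esub> (uq_relators q)"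

definition uq :: "'f::field \<Rightarrow> 'f free_alg set ring" where
  "uq q = free_ring Quot uq_ideal q"

definition uq_class :: "'f::field \<Rightarrow> 'f free_alg \<Rightarrow> 'f free_alg set" where
  "uq_class q p = uq_ideal q +>\<^bsub>free_ring\<^esub> p"

text \<open>The structure map \<open>\<bbbF> \<rightarrow> U\<^sub>q(sl\<^sub>2)\<close> making the quotient ring an \<open>\<bbbF>\<close>-algebra.\<close>

definition uq_scalar :: "'f::field \<Rightarrow> 'f \<Rightarrow> 'f free_alg set" where
  "uq_scalar q c = uq_class q (fscalar c)"

definition uq_smult :: "'f::field \<Rightarrow> 'f \<Rightarrow> 'f free_alg set \<Rightarrow> 'f free_alg set" where
  "uq_smult q c u = uq_scalar q c \<otimes>\<^bsub>uq q\<^esub> u"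

definition uq_x :: "'f::field \<Rightarrow> 'f free_alg set" where "uq_x q = uq_class q (fgen Gx)"
definition uq_y :: "'f::field \<Rightarrow> 'f free_alg set" where "uq_y q = uq_class q (fgen Gy)"
definition uq_yi :: "'f::field \<Rightarrow> 'f free_alg set" where "uq_yi q = uq_class q (fgen Gyi)"
definition uq_z :: "'f::field \<Rightarrow> 'f free_alg set" where "uq_z q = uq_class q (fgen Gz)"

lemma ideal_uq_ideal: "ideal (uq_ideal q) free_ring"
  unfolding uq_ideal_def
  by (rule ring.genideal_ideal[OF ring_free_ring]) (simp add: free_ring_def)

lemma ring_uq: "ring (uq q)"
  unfolding uq_def by (rule ideal.quotient_is_ring[OF ideal_uq_ideal])

lemma uq_class_hom: "uq_class q \<in> ring_hom free_ring (uq q)"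
  unfolding uq_class_def[abs_def] uq_def by (rule ideal.rcos_ring_hom[OF ideal_uq_ideal])

lemma uq_class_closed [simp]: "uq_class q p \<in> carrier (uq q)"
  and uq_class_add: "uq_class q (p + p') = uq_class q p \<oplus>\<^bsub>uq q\<^esub> uq_class q p'"
  and uq_class_mult: "uq_class q (p * p') = uq_class q p \<otimes>\<^bsub>uq q\<^esub> uq_class q p'"
  and uq_class_one: "uq_class q 1 = \<one>\<^bsub>uq q\<^esub>"
  using uq_class_hom[of q] by (auto simp: ring_hom_def free_ring_def)

lemma uq_class_diff: "uq_class q (p - p') = uq_class q p \<ominus>\<^bsub>uq q\<^esub> uq_class q p'"
proof -
  interpret ring "uq q" by (rule ring_uq)
  have "uq_class q p = uq_class q (p - p') \<oplus>\<^bsub>uq q\<^esub> uq_class q p'"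
    by (simp flip: uq_class_add)
  then show ?thesis
    by (simp add: a_minus_def a_assoc r_neg)
qed

lemma uq_class_eqI: "p - p' \<in> uq_ideal q \<Longrightarrow> uq_class q p = uq_class q p'"
proof -
  assume h: "p - p' \<in> uq_ideal q"
  interpret R: ring "uq q" by (rule ring_uq)
  interpret I: ideal "uq_ideal q" "free_ring" by (rule ideal_uq_ideal)
  have "uq_class q (p - p') = uq_ideal q"
    unfolding uq_class_def using h by (rule I.a_rcos_const)
  then have z: "uq_class q (p - p') = \<zero>\<^bsub>uq q\<^esub>"
    by (simp add: uq_def FactRing_def)
  have "uq_class q p = uq_class q (p - p') \<oplus>\<^bsub>uq q\<^esub> uq_class q p'"
    by (simp flip: uq_class_add)
  with z show ?thesis by simp
qed

lemma uq_relators_in_ideal: "uq_relators q \<subseteq> uq_ideal q"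
  unfolding uq_ideal_def
  by (rule ring.genideal_self[OF ring_free_ring]) (simp add: free_ring_def)

text \<open>The unital subalgebra generated by \<open>x, y\<^sup>-\<^sup>1, z\<close>: the subring generated by these elements
  together with the scalars.\<close>

definition uq_vee_carrier :: "'f::field \<Rightarrow> 'f free_alg set set" where
  "uq_vee_carrier q = generate_ring (uq q) (range (uq_scalar q) \<union> {uq_x q, uq_yi q, uq_z q})"

definition uq_vee :: "'f::field \<Rightarrow> 'f free_alg set ring" where
  "uq_vee q = (uq q)\<lparr>carrier := uq_vee_carrier q\<rparr>"

definition uq_X :: "'f::field \<Rightarrow> 'f \<Rightarrow> 'f free_alg set" where
  "uq_X q a = uq_smult q (inverse (a^2)) (uq_x q) \<oplus>\<^bsub>uq q\<^esub> uq_smult q (1 - inverse (a^2)) (uq_yi q)"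

definition uq_Z :: "'f::field \<Rightarrow> 'f \<Rightarrow> 'f free_alg set" where
  "uq_Z q a = uq_smult q (a^2) (uq_z q) \<oplus>\<^bsub>uq q\<^esub> uq_smult q (1 - a^2) (uq_yi q)"

definition uq_A :: "'f::field \<Rightarrow> 'f \<Rightarrow> 'f free_alg set" where
  "uq_A q a = uq_smult q (inverse a) (uq_x q) \<oplus>\<^bsub>uq q\<^esub> uq_smult q a (uq_z q)"

definition uq_nu_z :: "'f::field \<Rightarrow> 'f free_alg set" where
  "uq_nu_z q = uq_smult q q (\<one>\<^bsub>uq q\<^esub> \<ominus>\<^bsub>uq q\<^esub> uq_x q \<otimes>\<^bsub>uq q\<^esub> uq_y q)"


lemma fscalar_mult: "fscalar c * fscalar c' = fscalar (c * c')"
  and fscalar_one: "fscalar 1 = 1"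
  and fscalar_add: "fscalar (c + c') = fscalar c + fscalar c'"
  and fscalar_diff: "fscalar (c - c') = fscalar c - fscalar c'"
  by (simp_all add: fscalar_def mult_single single_add single_diff)

lemma fscalar_fgen_commute: "fscalar c * fgen g = fgen g * fscalar c"
  by (simp add: fscalar_def fgen_def mult_single)

lemma uq_A_alt:
  assumes "a \<noteq> 0"
  shows "uq_A q a = uq_smult q a (uq_X q a) \<oplus>\<^bsub>uq q\<^esub> uq_smult q (inverse a) (uq_Z q a)"
proof -
  have "fscalar a * (fscalar (inverse (a^2)) * fgen Gx + fscalar (1 - inverse (a^2)) * fgen Gyi)
      + fscalar (inverse a) * (fscalar (a^2) * fgen Gz + fscalar (1 - a^2) * fgen Gyi)
      = fscalar (inverse a) * fgen Gx + fscalar a * fgen Gz"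
    using assms
    by (simp add: distrib_left mult.assoc[symmetric] fscalar_mult right_diff_distrib fscalar_diff
        left_diff_distrib power2_eq_square)
  from arg_cong[OF this, of "uq_class q"] show ?thesis
    by (simp add: uq_A_def uq_X_def uq_Z_def uq_smult_def uq_scalar_def uq_x_def uq_z_def uq_yi_def
        uq_class_add uq_class_mult)
qed

lemma uq_nu_z_alt:
  fixes q :: "'a::field"
  assumes "q \<noteq> 0" "q^4 \<noteq> 1"
  shows "uq_nu_z q = uq_smult q (inverse q) (\<one>\<^bsub>uq q\<^esub> \<ominus>\<^bsub>uq q\<^esub> uq_y q \<otimes>\<^bsub>uq q\<^esub> uq_x q)"
proof -
  define h where "h = q - inverse q"
  have "h \<noteq> 0"
  proof
    assume "h = 0"
    then have "q * q = 1" using assms(1) by (simp add: h_def field_simps)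
    then have "q^4 = 1" by (simp add: power4_eq_xxxx mult.assoc)
    with assms(2) show False ..
  qed
  interpret I: ideal "uq_ideal q" "free_ring" by (rule ideal_uq_ideal)
  have "q_weyl q Gx Gy \<in> uq_ideal q"
    using uq_relators_in_ideal by (auto simp: uq_relators_def)
  then have "fscalar (- h) * q_weyl q Gx Gy \<in> uq_ideal q"
    using I.I_l_closed[of _ "fscalar (- h)"] by (simp add: free_ring_def)
  also have "fscalar (- h) * q_weyl q Gx Gy =
      fscalar q * (1 - fgen Gx * fgen Gy) - fscalar (inverse q) * (1 - fgen Gy * fgen Gx)"
  proof -
    have 1: "fscalar (- h) * fscalar (inverse h) = fscalar (- 1)"
      using \<open>h \<noteq> 0\<close> by (simp add: fscalar_mult)
    have 2: "fscalar (- 1) = (- 1 :: 'a free_alg)"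
      by (simp add: fscalar_def single_uminus)
    have 3: "fscalar (- h) = fscalar (inverse q) - fscalar q"
      by (simp add: h_def flip: fscalar_diff)
    have "fscalar (- h) * q_weyl q Gx Gy =
        (fscalar (- h) * fscalar (inverse h)) *
          (fscalar q * fgen Gx * fgen Gy - fscalar (inverse q) * fgen Gy * fgen Gx) - fscalar (- h)"
      unfolding q_weyl_def h_def[symmetric] by (simp only: right_diff_distrib mult.assoc mult_1_right)
    also have "\<dots> = fscalar q * (1 - fgen Gx * fgen Gy) - fscalar (inverse q) * (1 - fgen Gy * fgen Gx)"
      unfolding 1 unfolding 2 3 by (simp add: right_diff_distrib mult.assoc)
    finally show ?thesis .
  qed
  finally have "uq_class q (fscalar q * (1 - fgen Gx * fgen Gy)) =
      uq_class q (fscalar (inverse q) * (1 - fgen Gy * fgen Gx))"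
    by (rule uq_class_eqI)
  then show ?thesis
    by (simp add: uq_nu_z_def uq_smult_def uq_scalar_def uq_x_def uq_y_def
        uq_class_mult uq_class_diff uq_class_one)
qed


section \<open>Modules over a noncommutative algebra\<close>

text \<open>\<open>act u v\<close> is the action of \<open>u \<in> R\<close> on the vector \<open>v\<close>; \<open>\<iota>\<close> is the structure map of the
  algebra \<open>R\<close>, and the last clause says that the action induces the given vector space structure.
  (The library's module locales only cover commutative rings.)\<close>

definition algebra_module ::
  "('f::field \<Rightarrow> 'v::ab_group_add \<Rightarrow> 'v) \<Rightarrow> 'r ring \<Rightarrow> ('f \<Rightarrow> 'r) \<Rightarrow> ('r \<Rightarrow> 'v \<Rightarrow> 'v) \<Rightarrow> bool" where
  "algebra_module scale R \<iota> act \<longleftrightarrow>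
     (\<forall>u\<in>carrier R. \<forall>v w. act u (v + w) = act u v + act u w) \<and>
     (\<forall>u\<in>carrier R. \<forall>u'\<in>carrier R. \<forall>v. act (u \<oplus>\<^bsub>R\<^esub> u') v = act u v + act u' v) \<and>
     (\<forall>u\<in>carrier R. \<forall>u'\<in>carrier R. \<forall>v. act (u \<otimes>\<^bsub>R\<^esub> u') v = act u (act u' v)) \<and>
     (\<forall>v. act \<one>\<^bsub>R\<^esub> v = v) \<and>
     (\<forall>c v. act (\<iota> c) v = scale c v)"

definition uq_module ::
  "('f::field \<Rightarrow> 'v::ab_group_add \<Rightarrow> 'v) \<Rightarrow> 'f \<Rightarrow> ('f free_alg set \<Rightarrow> 'v \<Rightarrow> 'v) \<Rightarrow> bool" where
  "uq_module scale q act \<longleftrightarrow> algebra_module scale (uq q) (uq_scalar q) act"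

definition uq_vee_module ::
  "('f::field \<Rightarrow> 'v::ab_group_add \<Rightarrow> 'v) \<Rightarrow> 'f \<Rightarrow> ('f free_alg set \<Rightarrow> 'v \<Rightarrow> 'v) \<Rightarrow> bool" where
  "uq_vee_module scale q act \<longleftrightarrow> algebra_module scale (uq_vee q) (uq_scalar q) act"

definition extends_uq_vee_module ::
  "('f::field \<Rightarrow> 'v::ab_group_add \<Rightarrow> 'v) \<Rightarrow> 'f \<Rightarrow> ('f free_alg set \<Rightarrow> 'v \<Rightarrow> 'v)
    \<Rightarrow> ('f free_alg set \<Rightarrow> 'v \<Rightarrow> 'v) \<Rightarrow> bool" where
  "extends_uq_vee_module scale q act act' \<longleftrightarrow>
     uq_module scale q act' \<and> (\<forall>u\<in>carrier (uq_vee q). act' u = act u)"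

end

theory Submission
  imports Defs
begin

text \<open>Write \<open>x, Y, X\<close> for the actions of \<open>x, y\<^sup>-\<^sup>1, X\<close>.  Extending the module amounts to showing that \<open>Y\<close> is
  invertible.  The relations \<open>(A - \<theta>\<^sub>i) U\<^sub>i \<subseteq> U\<^sub>i\<^sub>+\<^sub>1\<close> and \<open>(A\<^sup>* - \<theta>\<^sup>*\<^sub>i) U\<^sub>i \<subseteq> U\<^sub>i\<^sub>-\<^sub>1\<close> make \<open>\<Sum> U\<^sub>i\<close> invariant
  under the pair, so irreducibility gives \<open>V = \<Sum> U\<^sub>i\<close>; reversing the order of the \<open>V\<^sub>i\<close> gives the same for
  the second decomposition, and \<open>K\<close>, \<open>B\<close> are bijective.  The kernel of \<open>Y\<close> is \<open>x\<close>-invariant and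
  \<open>X = a\<^sup>-\<^sup>2 x\<close> on it, which together with the restrictions on \<open>a\<close> would yield a common eigenvector of
  \<open>A\<close> and \<open>A\<^sup>*\<close> if it were nonzero.  Finally \<open>a I - a\<^sup>-\<^sup>1 B K\<^sup>-\<^sup>1 = (a - a\<^sup>-\<^sup>1) B Y\<close>, from which both the
  invertibility needed for \<open>\<psi>\<close> and the formula for \<open>\<nu>\<^sub>z\<close> follow.\<close>

section \<open>Split decompositions\<close>

context vector_space
begin

lemma linear_image_in_span:
  assumes "Vector_Spaces.linear scale scale g" "\<And>s. s \<in> S \<Longrightarrow> g s \<in> span T" "v \<in> span S"
  shows "g v \<in> span T"
proof -
  interpret g: Vector_Spaces.linear scale scale g by fact
  show ?thesis
    using assms(3)
    by (induction rule: span_induct_alt) (auto simp: g.add g.scale assms(2) span_zero span_add span_scale)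
qed

lemma linear_diff_scale:
  assumes "Vector_Spaces.linear scale scale f"
  shows "Vector_Spaces.linear scale scale (\<lambda>v. f v - scale c v)"
proof -
  interpret f: Vector_Spaces.linear scale scale f by fact
  show ?thesis
    by unfold_locales (simp_all add: f.add f.scale algebra_simps)
qed

text \<open>The map \<open>f - c j\<close> annihilates \<open>U j\<close> and rescales every other
  \<open>U i\<close> by \<open>c i - c j\<close>. This removes one index per step in the induction
  that follows.\<close>

lemma eigenvector_family_split_off:
  assumes f: "Vector_Spaces.linear scale scale f"
    and U: "\<And>i. i \<in> I \<Longrightarrow> subspace (U i)"
    and eig: "\<And>i v. i \<in> I \<Longrightarrow> v \<in> U i \<Longrightarrow> f v = scale (c i) v"
    and w: "w \<in> span (\<Union>i\<in>I. U i)"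
  shows "f w - scale (c j) w \<in> span (\<Union>i\<in>I - {j}. U i)"
proof (rule linear_image_in_span[OF linear_diff_scale[OF f] _ w])
  fix s assume "s \<in> (\<Union>i\<in>I. U i)"
  then obtain i where i: "i \<in> I" "s \<in> U i" by blast
  then have "f s - scale (c j) s = scale (c i - c j) s"
    by (simp add: eig scale_left_diff_distrib)
  also have "\<dots> \<in> span (\<Union>i\<in>I - {j}. U i)"
  proof (cases "i = j")
    case False
    with i have "s \<in> (\<Union>i\<in>I - {j}. U i)" by auto
    then show ?thesis by (intro span_scale span_base)
  qed (simp add: span_zero)
  finally show "f s - scale (c j) s \<in> span (\<Union>i\<in>I - {j}. U i)" .
qed

text \<open>Induction on the index set. If some \<open>f w - c j w\<close> is nonzero, it still lies
  in \<open>W\<close> but involves one index fewer. Otherwise \<open>w\<close> has every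
  \<open>c j\<close> as eigenvalue, and injectivity of \<open>c\<close> leaves a single
  index.\<close>

lemma invariant_subspace_meets_eigenspace:
  assumes f: "Vector_Spaces.linear scale scale f"
    and W: "subspace W" "f ` W \<subseteq> W"
    and I: "finite I" "inj_on c I"
    and U: "\<And>i. i \<in> I \<Longrightarrow> subspace (U i)"
    and eig: "\<And>i v. i \<in> I \<Longrightarrow> v \<in> U i \<Longrightarrow> f v = scale (c i) v"
    and w: "w \<in> W" "w \<noteq> 0" "w \<in> span (\<Union>i\<in>I. U i)"
  shows "\<exists>i\<in>I. \<exists>u\<in>W \<inter> U i. u \<noteq> 0"
  using I U eig w
proof (induction I arbitrary: w rule: finite_psubset_induct)
  case (psubset I)
  show ?case
  proof (cases "\<exists>j\<in>I. f w - scale (c j) w \<noteq> 0")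
    case True
    then obtain j where j: "j \<in> I" "f w - scale (c j) w \<noteq> 0" by blast
    have "\<exists>i\<in>I - {j}. \<exists>u\<in>W \<inter> U i. u \<noteq> 0"
    proof (rule psubset.IH[of _ "f w - scale (c j) w"])
      show "I - {j} \<subset> I" using j by blast
      show "inj_on c (I - {j})" using psubset.prems(1) by (rule inj_on_subset) blast
      show "f w - scale (c j) w \<in> W"
        using W psubset.prems(4) by (auto intro: subspace_diff subspace_scale)
      show "f w - scale (c j) w \<in> span (\<Union>i\<in>I - {j}. U i)"
        by (rule eigenvector_family_split_off[OF f]) (use psubset.prems in auto)
    qed (use psubset.prems j in auto)
    then show ?thesis by blast
  next
    case False
    \<comment> \<open>The span over an empty index set is zero, whereas \<open>w\<close> is
      not.\<close>
    have "I \<noteq> {}" using psubset.prems by auto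
    then obtain i where i: "i \<in> I" by blast
    have "j = i" if "j \<in> I" for j
    proof -
      have "f w = scale (c k) w" if "k \<in> I" for k
        using False that by (metis eq_iff_diff_eq_0)
      from this[OF i] this[OF \<open>j \<in> I\<close>] have "scale (c i) w = scale (c j) w" by metis
      then have "c i = c j" using psubset.prems(5) by simp
      then show ?thesis using psubset.prems(1) i that by (auto dest: inj_onD)
    qed
    then have "I = {i}" using i by blast
    then have "w \<in> U i" using psubset.prems(6) psubset.prems(2)[OF i] by (simp add: span_eq_iff[THEN iffD2])
    then show ?thesis using i psubset.prems by blast
  qed
qed

text \<open>The line spanned by \<open>w\<close> is invariant, so the previous lemma puts a nonzero
  multiple of \<open>w\<close> into some \<open>U i\<close>, which forces the eigenvalue to be
  \<open>c i\<close>.\<close>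

lemma eigenvector_in_eigenspace_family:
  assumes f: "Vector_Spaces.linear scale scale f"
    and I: "finite I" "inj_on c I"
    and U: "\<And>i. i \<in> I \<Longrightarrow> subspace (U i)"
    and eig: "\<And>i v. i \<in> I \<Longrightarrow> v \<in> U i \<Longrightarrow> f v = scale (c i) v"
    and span: "span (\<Union>i\<in>I. U i) = UNIV"
    and w: "w \<noteq> 0" "f w = scale k w"
  shows "\<exists>i\<in>I. w \<in> U i \<and> k = c i"
proof -
  interpret f: Vector_Spaces.linear scale scale f by fact
  have "\<exists>i\<in>I. \<exists>u\<in>span {w} \<inter> U i. u \<noteq> 0"
  proof (rule invariant_subspace_meets_eigenspace[OF f _ _ I U eig])
    show "f ` span {w} \<subseteq> span {w}"
      by (auto simp: span_singleton f.scale w(2) mult.commute)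
  qed (use w span in \<open>auto intro: span_base\<close>)
  then obtain i t where i: "i \<in> I" "scale t w \<in> U i" "scale t w \<noteq> 0"
    by (auto simp: span_singleton)
  then have "t \<noteq> 0" by auto
  have "w = scale (inverse t) (scale t w)" using \<open>t \<noteq> 0\<close> by simp
  then have wU: "w \<in> U i" using U[OF i(1)] i(2) by (metis subspace_scale)
  then have "scale (c i) w = scale k w" using eig i(1) w(2) by metis
  then show ?thesis using wU i(1) w(1) by auto
qed

end

text \<open>Each \<open>v\<close> in \<open>U i\<close> has the preimage
  \<open>scale (inverse (c i)) v\<close>, so the range contains a spanning set; in finite dimension
  surjectivity gives injectivity. This identifies the inverses of \<open>K\<close> and
  \<open>B\<close> on the split decompositions.\<close>

lemma (in finite_dimensional_vector_space) bij_of_spanning_eigenvectors: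
  assumes f: "Vector_Spaces.linear scale scale f"
    and eig: "\<And>i v. i \<in> I \<Longrightarrow> v \<in> U i \<Longrightarrow> f v = scale (c i) v"
    and c: "\<And>i. i \<in> I \<Longrightarrow> c i \<noteq> 0"
    and span: "span (\<Union>i\<in>I. U i) = UNIV"
  shows "bij f"
    and "\<And>i v. i \<in> I \<Longrightarrow> v \<in> U i \<Longrightarrow> inv_into UNIV f v = scale (inverse (c i)) v"
proof -
  interpret f: Vector_Spaces.linear scale scale f by fact
  have pre: "f (scale (inverse (c i)) v) = v" if "i \<in> I" "v \<in> U i" for i v
    using that c by (simp add: f.scale eig)
  have "(\<Union>i\<in>I. U i) \<subseteq> range f"
    using pre by (metis UN_least rangeI subsetI)
  then have "span (\<Union>i\<in>I. U i) \<subseteq> range f"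
    by (rule span_minimal) (rule f.subspace_image[OF subspace_UNIV])
  then have "surj f" using span by blast
  then have "inj f" using linear_surj_imp_inj[OF f] by blast
  then show "bij f" using \<open>surj f\<close> by (simp add: bij_def)
  show "inv_into UNIV f v = scale (inverse (c i)) v" if "i \<in> I" "v \<in> U i" for i v
    using pre[OF that] \<open>inj f\<close> by (metis inv_f_f)
qed

lemma (in vector_space) subspace_eigenspace:
  "Vector_Spaces.linear scale scale f \<Longrightarrow> subspace (eigenspace scale f t)"
proof -
  assume "Vector_Spaces.linear scale scale f"
  then interpret f: Vector_Spaces.linear scale scale f .
  show ?thesis
    unfolding subspace_def eigenspace_def
    by (simp add: f.zero f.add f.scale scale_right_distrib mult.commute)
qed

lemma (in vector_space) subspace_split_U: "subspace (split_U scale d V Vs i)"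
  by (auto simp: split_U_def subspace_sum_def intro: subspace_inter)

section \<open>Eigenspace orderings, their reversal, and the split spaces\<close>

lemma subspace_sum_eigenspaces:
  assumes "diagonalizable scale f" "tridiagonal_ordering scale f g d W"
  shows "subspace_sum scale W {0..d} = UNIV"
  using assms by (auto simp: diagonalizable_def tridiagonal_ordering_def subspace_sum_def bij_betw_def)

text \<open>The index condition is symmetric under replacing \<open>i\<close> by
  \<open>d - i\<close>. Reversal gives access to the second split decomposition and to the lowering
  maps.\<close>

lemma tridiagonal_ordering_reverse:
  assumes "tridiagonal_ordering scale f g d W"
  shows "tridiagonal_ordering scale f g d (\<lambda>i. W (d - i))"
proof -
  have bij: "bij_betw (\<lambda>i. d - i) {0..d} {0..d}"
    by (rule bij_betw_byWitness[where f' = "\<lambda>i. d - i"]) auto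
  have "g ` W (d - i) \<subseteq> subspace_sum scale (\<lambda>i. W (d - i)) {j. j \<le> d \<and> j \<le> i + 1 \<and> i \<le> j + 1}"
    if "i \<le> d" for i
  proof -
    have "{j. j \<le> d \<and> j \<le> d - i + 1 \<and> d - i \<le> j + 1} = (\<lambda>j. d - j) ` {j. j \<le> d \<and> j \<le> i + 1 \<and> i \<le> j + 1}"
      (is "?L = _ ` ?R")
    proof (intro equalityI subsetI)
      fix j assume "j \<in> ?L"
      then show "j \<in> (\<lambda>j. d - j) ` ?R" by (intro image_eqI[of _ _ "d - j"]) (use that in auto)
    qed (use that in auto)
    then have "(\<Union>j\<in>?L. W j) = (\<Union>j\<in>?R. W (d - j))" by simp
    moreover have "g ` W (d - i) \<subseteq> subspace_sum scale W ?L"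
      using assms by (simp add: tridiagonal_ordering_def)
    ultimately show ?thesis by (simp add: subspace_sum_def)
  qed
  moreover have "bij_betw (\<lambda>i. W (d - i)) {0..d} (eigenspaces scale f)"
    using bij_betw_trans[OF bij, of W] assms by (simp add: tridiagonal_ordering_def comp_def)
  ultimately show ?thesis by (simp add: tridiagonal_ordering_def)
qed

text \<open>Carries every fact about \<open>split_U\<close> over to the second
  decomposition.\<close>

lemma split_U_down_eq_split_U:
  assumes "i \<le> d"
  shows "split_U_down scale d V Vs i = split_U scale d (\<lambda>i. V (d - i)) Vs i"
proof -
  have "{0..d - i} = (\<lambda>j. d - j) ` {i..d}"
  proof (intro equalityI subsetI)
    fix j assume "j \<in> {0..d - i}"
    then show "j \<in> (\<lambda>j. d - j) ` {i..d}" by (intro image_eqI[of _ _ "d - j"]) (use assms in auto)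
  qed auto
  then show ?thesis by (simp add: split_U_down_def split_U_def subspace_sum_def image_image)
qed

text \<open>The map \<open>f - \<theta> i\<close> kills \<open>V i\<close>, leaving only later
  \<open>V j\<close>, while tridiagonality lets \<open>f\<close> enlarge a partial sum of
  \<open>Vs\<close> by at most one index. The maps \<open>f\<close> and \<open>g\<close> are kept
  general so that either member of the pair can play the part of \<open>f\<close>.\<close>

lemma (in vector_space) split_U_raise:
  assumes lin: "Vector_Spaces.linear scale scale f"
    and ord: "tridiagonal_ordering scale g f d Vs"
    and eig: "\<And>i v. i \<le> d \<Longrightarrow> v \<in> V i \<Longrightarrow> f v = scale (\<theta> i) v"
    and i: "i \<le> d" and u: "u \<in> split_U scale d V Vs i"
  shows "f u - scale (\<theta> i) u \<in> (if i < d then split_U scale d V Vs (Suc i) else {0})"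
proof -
  have "f u - scale (\<theta> i) u \<in> span (\<Union>j\<in>{i..d} - {i}. V j)"
  proof (rule linear_image_in_span[OF linear_diff_scale[OF lin]])
    show "u \<in> span (\<Union>j\<in>{i..d}. V j)" using u by (simp add: split_U_def subspace_sum_def)
    fix s assume "s \<in> (\<Union>j\<in>{i..d}. V j)"
    then obtain j where j: "j \<in> {i..d}" "s \<in> V j" by blast
    then have "f s - scale (\<theta> i) s = scale (\<theta> j - \<theta> i) s"
      by (simp add: eig scale_left_diff_distrib)
    also have "\<dots> \<in> span (\<Union>j\<in>{i..d} - {i}. V j)"
    proof (cases "j = i")
      case False
      with j have "s \<in> (\<Union>j\<in>{i..d} - {i}. V j)" by auto
      then show ?thesis by (intro span_scale span_base)
    qed (simp add: span_zero)
    finally show "f s - scale (\<theta> i) s \<in> span (\<Union>j\<in>{i..d} - {i}. V j)" .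
  qed
  moreover have "{i..d} - {i} = {Suc i..d}" by auto
  ultimately have up: "f u - scale (\<theta> i) u \<in> span (\<Union>j\<in>{Suc i..d}. V j)" by simp
  \<comment> \<open>For \<open>i = d\<close> this sum reaches index \<open>d + 1\<close>, outside
    the ordering; that case is settled by \<open>up\<close> alone, whose sum is then empty.\<close>
  have down: "f u - scale (\<theta> i) u \<in> span (\<Union>j\<in>{0..Suc i}. Vs j)"
  proof (rule linear_image_in_span[OF linear_diff_scale[OF lin]])
    show "u \<in> span (\<Union>j\<in>{0..i}. Vs j)" using u by (simp add: split_U_def subspace_sum_def)
    fix s assume "s \<in> (\<Union>j\<in>{0..i}. Vs j)"
    then obtain k where k: "k \<le> i" "s \<in> Vs k" by auto
    then have "f s \<in> span (\<Union>j\<in>{j. j \<le> d \<and> j \<le> k + 1 \<and> k \<le> j + 1}. Vs j)"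
      using ord i by (simp add: tridiagonal_ordering_def subspace_sum_def image_subset_iff)
    also have "\<dots> \<subseteq> span (\<Union>j\<in>{0..Suc i}. Vs j)"
      using k by (intro span_mono UN_mono) auto
    finally have "f s \<in> span (\<Union>j\<in>{0..Suc i}. Vs j)" .
    moreover have "s \<in> span (\<Union>j\<in>{0..Suc i}. Vs j)"
      using k by (intro span_base) auto
    ultimately show "f s - scale (\<theta> i) s \<in> span (\<Union>j\<in>{0..Suc i}. Vs j)"
      by (intro span_diff span_scale)
  qed
  show ?thesis
  proof (cases "i < d")
    case True
    then show ?thesis using up down by (simp add: split_U_def subspace_sum_def)
  next
    case False
    then show ?thesis using up i by simp
  qed
qed

text \<open>The two factors of the intersection change places, so the same spaces appear in the
  opposite order.\<close>

lemma split_U_reverse: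
  assumes "i \<le> d"
  shows "split_U scale d (\<lambda>j. Vs (d - j)) (\<lambda>j. V (d - j)) (d - i) = split_U scale d V Vs i"
proof -
  have 1: "(\<lambda>j. d - j) ` {0..d - i} = {i..d}"
  proof (intro equalityI subsetI)
    fix j assume "j \<in> {i..d}"
    then show "j \<in> (\<lambda>j. d - j) ` {0..d - i}" by (intro image_eqI[of _ _ "d - j"]) (use assms in auto)
  qed (use assms in auto)
  have 2: "(\<lambda>j. d - j) ` {d - i..d} = {0..i}"
  proof (intro equalityI subsetI)
    fix j assume "j \<in> {0..i}"
    then show "j \<in> (\<lambda>j. d - j) ` {d - i..d}" by (intro image_eqI[of _ _ "d - j"]) (use assms in auto)
  qed (use assms in auto)
  have "(\<Union>j\<in>{0..d - i}. V (d - j)) = (\<Union>j\<in>{i..d}. V j)"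
    "(\<Union>j\<in>{d - i..d}. Vs (d - j)) = (\<Union>j\<in>{0..i}. Vs j)"
    unfolding 1[symmetric] 2[symmetric] by blast+
  then show ?thesis by (auto simp: split_U_def subspace_sum_def)
qed

text \<open>The span is invariant under \<open>A\<close>, which raises the index by at most one, and
  under \<open>As\<close>, which lowers it by at most one, so irreducibility applies.\<close>

lemma (in vector_space) split_decomposition:
  assumes tp: "tridiagonal_pair scale A As"
    and V: "tridiagonal_ordering scale A As d V" "\<And>i. i \<le> d \<Longrightarrow> V i = eigenspace scale A (\<theta> i)"
    and Vs: "tridiagonal_ordering scale As A d Vs" "\<And>i. i \<le> d \<Longrightarrow> Vs i = eigenspace scale As (\<theta>s i)"
  shows "span (\<Union>i\<in>{0..d}. split_U scale d V Vs i) = UNIV"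
proof -
  define U where "U = split_U scale d V Vs"
  define W where "W = span (\<Union>i\<in>{0..d}. U i)"
  have lin: "Vector_Spaces.linear scale scale A" "Vector_Spaces.linear scale scale As"
    and diag: "diagonalizable scale A"
    and irr: "\<And>W. subspace W \<Longrightarrow> A ` W \<subseteq> W \<Longrightarrow> As ` W \<subseteq> W \<Longrightarrow> W \<noteq> {0} \<Longrightarrow> W = UNIV"
    using tp unfolding tridiagonal_pair_def by (blast, blast, blast, metis)
  have UW: "u \<in> W" if "i \<le> d" "u \<in> U i" for i u
    using that by (auto simp: W_def intro!: span_base)
  have "A u \<in> W" if "u \<in> (\<Union>i\<in>{0..d}. U i)" for u
  proof -
    from that obtain i where i: "i \<le> d" "u \<in> U i" by auto
    have "A u - scale (\<theta> i) u \<in> (if i < d then U (Suc i) else {0})"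
      unfolding U_def
      by (rule split_U_raise[OF lin(1) Vs(1)]) (use i V in \<open>auto simp: U_def eigenspace_def\<close>)
    then have "A u - scale (\<theta> i) u \<in> W"
      using UW[of "Suc i"] by (auto simp: W_def span_zero split: if_splits)
    moreover have "scale (\<theta> i) u \<in> W" using UW i by (auto simp: W_def intro: span_scale)
    ultimately show ?thesis unfolding W_def by (metis span_add diff_add_cancel)
  qed
  then have A: "A ` W \<subseteq> W" using linear_image_in_span[OF lin(1)] unfolding W_def by blast
  text \<open>Reversing both orderings and exchanging \<open>V\<close> with \<open>Vs\<close> turns raising by \<open>A\<close> into lowering by \<open>As\<close>.\<close>
  have "As u \<in> W" if "u \<in> (\<Union>i\<in>{0..d}. U i)" for u
  proof -
    from that obtain i where i: "i \<le> d" "u \<in> U i" by auto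
    have "As u - scale (\<theta>s i) u \<in>
      (if d - i < d then split_U scale d (\<lambda>j. Vs (d - j)) (\<lambda>j. V (d - j)) (Suc (d - i)) else {0})"
    proof (rule split_U_raise[OF lin(2) tridiagonal_ordering_reverse[OF V(1)],
          where V = "\<lambda>j. Vs (d - j)" and \<theta> = "\<lambda>j. \<theta>s (d - j)" and i = "d - i" and u = u,
          unfolded diff_diff_cancel[OF i(1)]])
      show "As v = scale (\<theta>s (d - j)) v" if "v \<in> Vs (d - j)" for j v
        using that Vs(2)[of "d - j"] by (simp add: eigenspace_def)
      show "u \<in> split_U scale d (\<lambda>j. Vs (d - j)) (\<lambda>j. V (d - j)) (d - i)"
        using i by (simp add: U_def split_U_reverse)
    qed simp
    \<comment> \<open>The condition \<open>d - i < d\<close> excludes \<open>i = 0\<close>, so the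
      truncated \<open>i - 1\<close> is the true predecessor and
      \<open>Suc (d - i) = d - (i - 1)\<close>.\<close>
    moreover have "split_U scale d (\<lambda>j. Vs (d - j)) (\<lambda>j. V (d - j)) (Suc (d - i)) = U (i - 1)"
      if "d - i < d"
      using split_U_reverse[of "i - 1" d scale Vs V] that i by (simp add: U_def Suc_diff_le)
    ultimately have "As u - scale (\<theta>s i) u \<in> W"
      using UW[of "i - 1"] i by (auto simp: W_def span_zero split: if_splits)
    moreover have "scale (\<theta>s i) u \<in> W" using UW i by (auto simp: W_def intro: span_scale)
    ultimately show ?thesis unfolding W_def by (metis span_add diff_add_cancel)
  qed
  then have As: "As ` W \<subseteq> W" using linear_image_in_span[OF lin(2)] unfolding W_def by blast
  \<comment> \<open>\<open>W\<close> is nonzero because \<open>U 0\<close> contains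
    \<open>Vs 0\<close>: the other factor, the sum of all \<open>V j\<close>, is the whole
    space.\<close>
  have "Vs 0 \<in> eigenspaces scale As"
    using Vs(1) by (auto simp: tridiagonal_ordering_def bij_betw_def)
  then have "Vs 0 \<noteq> {0}" by (auto simp: eigenspaces_def)
  moreover have "0 \<in> Vs 0"
    using subspace_eigenspace[OF lin(2)] Vs(2)[of 0] by (simp add: subspace_0)
  ultimately obtain v where v: "v \<in> Vs 0" "v \<noteq> 0" by blast
  then have "v \<in> U 0"
    using subspace_sum_eigenspaces[OF diag V(1)]
    by (auto simp: U_def split_U_def subspace_sum_def intro: span_base)
  then have "W \<noteq> {0}" using UW v by blast
  then have "W = UNIV" using irr[OF _ A As] by (simp add: W_def)
  then show ?thesis by (simp add: W_def U_def)
qed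

section \<open>Representations of the free algebra and its quotient\<close>

text \<open>Updating at a fresh key amounts to adding a monomial. In this form additive statements
  need checking only on monomials.\<close>

lemma poly_mapping_additive_induct [case_names zero single add]:
  assumes "P 0" "\<And>k c. P (Poly_Mapping.single k c)" "\<And>f g. P f \<Longrightarrow> P g \<Longrightarrow> P (f + g)"
  shows "P (f :: 'a \<Rightarrow>\<^sub>0 'b::monoid_add)"
proof (induction f rule: update_induct)
  case const
  show ?case by (rule assms(1))
next
  case (update f k c)
  have "Poly_Mapping.update k c f = Poly_Mapping.single k c + f"
    using update(1)
    by (intro poly_mapping_eqI) (auto simp: lookup_update lookup_add lookup_single in_keys_iff when_def)
  then show ?case using assms(3)[OF assms(2) update(3)] by simp
qed

text \<open>With \<open>foldr\<close> the last letter acts first, so concatenation of words becomes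
  composition of maps, as a left action requires.\<close>

definition word_action :: "(uq_gen \<Rightarrow> 'v \<Rightarrow> 'v) \<Rightarrow> uq_word \<Rightarrow> 'v \<Rightarrow> 'v" where
  "word_action \<rho> w = foldr \<rho> (letters w)"

lemma word_action_zero [simp]: "word_action \<rho> 0 v = v"
  and word_action_gen [simp]: "word_action \<rho> (Word [g]) v = \<rho> g v"
  and word_action_plus: "word_action \<rho> (w + w') v = word_action \<rho> w (word_action \<rho> w' v)"
  by (simp_all add: word_action_def zero_uq_word_def plus_uq_word_def)

definition free_action ::
  "('f::field \<Rightarrow> 'v::ab_group_add \<Rightarrow> 'v) \<Rightarrow> (uq_gen \<Rightarrow> 'v \<Rightarrow> 'v) \<Rightarrow> 'f free_alg \<Rightarrow> 'v \<Rightarrow> 'v" where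
  "free_action scale \<rho> p v = (\<Sum>w\<in>Poly_Mapping.keys p. scale (Poly_Mapping.lookup p w) (word_action \<rho> w v))"

locale free_alg_rep = vector_space scale
  for scale :: "'f::field \<Rightarrow> 'v::ab_group_add \<Rightarrow> 'v" +
  fixes \<rho> :: "uq_gen \<Rightarrow> 'v \<Rightarrow> 'v"
  assumes linear_gen: "Vector_Spaces.linear scale scale (\<rho> g)"
begin

abbreviation rep :: "'f free_alg \<Rightarrow> 'v \<Rightarrow> 'v" where "rep \<equiv> free_action scale \<rho>"

lemma rep_superset:
  assumes "finite S" "Poly_Mapping.keys p \<subseteq> S"
  shows "rep p v = (\<Sum>w\<in>S. scale (Poly_Mapping.lookup p w) (word_action \<rho> w v))"
  unfolding free_action_def
  by (rule sum.mono_neutral_left) (use assms in \<open>auto simp: in_keys_iff\<close>)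

lemma rep_add: "rep (p + p') v = rep p v + rep p' v"
proof -
  let ?S = "Poly_Mapping.keys p \<union> Poly_Mapping.keys p'"
  have "Poly_Mapping.keys (p + p') \<subseteq> ?S" by (rule Poly_Mapping.keys_add)
  then show ?thesis
    by (simp add: rep_superset[of ?S] lookup_add scale_left_distrib sum.distrib)
qed

lemma rep_single: "rep (Poly_Mapping.single w c) v = scale c (word_action \<rho> w v)"
  by (simp add: rep_superset[of "{w}"])

lemma rep_zero: "rep 0 v = 0"
  by (simp add: free_action_def)

lemma linear_word: "Vector_Spaces.linear scale scale (word_action \<rho> w)"
proof -
  have "Vector_Spaces.linear scale scale (foldr \<rho> gs)" for gs
  proof (induction gs)
    case Nil
    show ?case by (simp add: module_hom_ident id_def linear_id)
  next
    case (Cons g gs)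
    show ?case
      using Vector_Spaces.linear_compose[OF Cons linear_gen] by (simp add: comp_def)
  qed
  then show ?thesis by (simp add: word_action_def)
qed

lemma
  shows rep_vadd: "rep p (v + v') = rep p v + rep p v'"
    and rep_vscale: "rep p (scale c v) = scale c (rep p v)"
proof -
  have 1: "word_action \<rho> w (v + v') = word_action \<rho> w v + word_action \<rho> w v'"
    "word_action \<rho> w (scale c v) = scale c (word_action \<rho> w v)" for w v v' c
    using linear_word[of w] by (auto simp: Vector_Spaces.linear_iff)
  show "rep p (v + v') = rep p v + rep p v'"
    by (simp add: free_action_def 1 scale_right_distrib sum.distrib)
  show "rep p (scale c v) = scale c (rep p v)"
    by (simp add: free_action_def 1 scale_sum_right mult.commute)
qed

text \<open>Both sides are additive in \<open>p\<close> and in \<open>p'\<close>, which reduces the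
  claim to monomials, where it is \<open>word_action_plus\<close> and linearity.\<close>

lemma rep_mult: "rep (p * p') v = rep p (rep p' v)"
proof (induction p rule: poly_mapping_additive_induct)
  case (single w c)
  show ?case
  proof (induction p' rule: poly_mapping_additive_induct)
    case zero
    show ?case using rep_vscale[of "Poly_Mapping.single w c" 0 0] by (simp add: rep_zero)
  next
    case (single w' c')
    show ?case
      by (simp add: mult_single rep_single word_action_plus Vector_Spaces.linear_iff[THEN iffD1, OF linear_word])
  next
    case (add f g)
    then show ?case by (simp add: distrib_left rep_add rep_vadd)
  qed
qed (simp_all add: rep_zero rep_add distrib_right)

lemma rep_fscalar: "rep (fscalar c) v = scale c v"
  and rep_fgen: "rep (fgen g) v = \<rho> g v"
  by (simp_all add: fscalar_def fgen_def rep_single)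

lemma rep_one: "rep 1 v = v"
  using rep_fscalar[of 1] by (simp add: fscalar_one)

lemma rep_uminus: "rep (- p) v = - rep p v"
  using rep_add[of p "- p" v] by (simp add: rep_zero eq_neg_iff_add_eq_0 add.commute)

lemma rep_diff: "rep (p - p') v = rep p v - rep p' v"
  using rep_add[of p "- p'" v] by (simp add: rep_uminus)

text \<open>The elements acting as zero form a two-sided ideal, which contains the ideal generated
  by the relators as soon as it contains the relators.\<close>

lemma rep_eq_zero_on_ideal:
  assumes "\<And>p v. p \<in> uq_relators q \<Longrightarrow> rep p v = 0" "p \<in> uq_ideal q"
  shows "rep p v = 0"
proof -
  have zero: "rep p 0 = 0" for p
    using rep_vscale[of p 0 0] by simp
  interpret R: ring "free_ring :: 'f free_alg ring" by (rule ring_free_ring)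
  have "ideal {p. \<forall>v. rep p v = 0} free_ring"
  proof (rule idealI[OF ring_free_ring])
    show "subgroup {p. \<forall>v. rep p v = 0} (add_monoid free_ring)"
    proof (rule group.subgroupI[OF R.a_group])
      show "{p. \<forall>v. rep p v = 0} \<noteq> {}" using rep_zero by auto
      fix p assume p: "p \<in> {p. \<forall>v. rep p v = 0}"
      have "inv\<^bsub>add_monoid free_ring\<^esub> p = - p"
        by (rule group.inv_equality[OF R.a_group]) (simp_all add: free_ring_def)
      then show "inv\<^bsub>add_monoid free_ring\<^esub> p \<in> {p. \<forall>v. rep p v = 0}"
        using p by (simp add: rep_uminus)
    qed (simp_all add: free_ring_def rep_add)
  qed (simp_all add: free_ring_def rep_mult zero)
  then have "uq_ideal q \<subseteq> {p. \<forall>v. rep p v = 0}"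
    unfolding uq_ideal_def by (rule R.genideal_minimal) (use assms(1) in auto)
  then show ?thesis using assms(2) by blast
qed

end

section \<open>Descent from the free algebra to the quotient\<close>

lemma carrier_uq: "carrier (uq q) = range (uq_class q)"
  by (auto simp: uq_def FactRing_def A_RCOSETS_def' uq_class_def free_ring_def)

lemma uq_class_eqD:
  assumes "uq_class q p = uq_class q p'"
  shows "p - p' \<in> uq_ideal q"
proof -
  interpret R: ring "uq q" by (rule ring_uq)
  interpret I: ideal "uq_ideal q" "free_ring" by (rule ideal_uq_ideal)
  have "uq_class q (p - p') = \<zero>\<^bsub>uq q\<^esub>"
    by (simp add: uq_class_diff assms R.r_neg a_minus_def)
  then show ?thesis
    by (intro I.rcos_const_imp_mem) (simp_all add: uq_def FactRing_def uq_class_def free_ring_def)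
qed

text \<open>A class acts through an arbitrarily chosen representative;
  \<open>uq_action_class\<close> shows that the choice does not matter once the relators act as
  zero.\<close>

definition uq_action ::
  "('f::field \<Rightarrow> 'v::ab_group_add \<Rightarrow> 'v) \<Rightarrow> 'f \<Rightarrow> (uq_gen \<Rightarrow> 'v \<Rightarrow> 'v) \<Rightarrow> 'f free_alg set \<Rightarrow> 'v \<Rightarrow> 'v" where
  "uq_action scale q \<rho> u = free_action scale \<rho> (SOME p. uq_class q p = u)"

locale uq_rep = free_alg_rep scale \<rho>
  for scale :: "'f::field \<Rightarrow> 'v::ab_group_add \<Rightarrow> 'v" and \<rho> +
  fixes q :: 'f
  assumes relators: "p \<in> uq_relators q \<Longrightarrow> free_action scale \<rho> p v = 0"
begin

text \<open>Two representatives of one class differ by an element of the ideal, which acts as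
  zero.\<close>

lemma uq_action_class: "uq_action scale q \<rho> (uq_class q p) = rep p"
proof
  fix v
  have "uq_class q (SOME p'. uq_class q p' = uq_class q p) = uq_class q p"
    by (rule someI) (rule refl)
  then have "rep ((SOME p'. uq_class q p' = uq_class q p) - p) v = 0"
    by (intro rep_eq_zero_on_ideal[OF relators]) (auto intro: uq_class_eqD)
  then show "uq_action scale q \<rho> (uq_class q p) v = rep p v"
    by (simp add: uq_action_def rep_diff)
qed

lemma uq_module_uq_action: "uq_module scale q (uq_action scale q \<rho>)"
  unfolding uq_module_def algebra_module_def carrier_uq
  by (auto simp: uq_action_class uq_scalar_def rep_vadd rep_add rep_mult rep_one rep_fscalar
      simp flip: uq_class_add uq_class_mult uq_class_one)

end

section \<open>The subalgebra generated by \<open>x\<close>, \<open>y^(-1)\<close>, \<open>z\<close>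
  and its relations\<close>

lemma uq_vee_carrier_subset: "uq_vee_carrier q \<subseteq> carrier (uq q)"
  unfolding uq_vee_carrier_def
  by (rule ring.generate_ring_incl[OF ring_uq])
    (auto simp: uq_scalar_def uq_x_def uq_yi_def uq_z_def)

lemma uq_vee_carrier_intros:
  "uq_scalar q c \<in> uq_vee_carrier q"
  "uq_x q \<in> uq_vee_carrier q" "uq_yi q \<in> uq_vee_carrier q" "uq_z q \<in> uq_vee_carrier q"
  "u \<in> uq_vee_carrier q \<Longrightarrow> u' \<in> uq_vee_carrier q \<Longrightarrow> u \<oplus>\<^bsub>uq q\<^esub> u' \<in> uq_vee_carrier q"
  "u \<in> uq_vee_carrier q \<Longrightarrow> u' \<in> uq_vee_carrier q \<Longrightarrow> u \<otimes>\<^bsub>uq q\<^esub> u' \<in> uq_vee_carrier q"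
  "u \<in> uq_vee_carrier q \<Longrightarrow> uq_smult q c u \<in> uq_vee_carrier q"
proof -
  show *: "uq_scalar q c \<in> uq_vee_carrier q"
    "uq_x q \<in> uq_vee_carrier q" "uq_yi q \<in> uq_vee_carrier q" "uq_z q \<in> uq_vee_carrier q"
    unfolding uq_vee_carrier_def by (rule generate_ring.incl, simp)+
  show "u \<oplus>\<^bsub>uq q\<^esub> u' \<in> uq_vee_carrier q" "u \<otimes>\<^bsub>uq q\<^esub> u' \<in> uq_vee_carrier q"
    if "u \<in> uq_vee_carrier q" "u' \<in> uq_vee_carrier q"
    using that unfolding uq_vee_carrier_def by (rule generate_ring.eng_add, rule generate_ring.eng_mult)
  show "uq_smult q c u \<in> uq_vee_carrier q" if "u \<in> uq_vee_carrier q"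
    using that *(1) unfolding uq_vee_carrier_def uq_smult_def by (intro generate_ring.eng_mult)
qed

lemma
  shows uq_ideal_mult: "p \<in> uq_ideal q \<Longrightarrow> l * p * r \<in> uq_ideal q"
    and uq_ideal_add: "p \<in> uq_ideal q \<Longrightarrow> p' \<in> uq_ideal q \<Longrightarrow> p + p' \<in> uq_ideal q"
    and uq_ideal_diff: "p \<in> uq_ideal q \<Longrightarrow> p' \<in> uq_ideal q \<Longrightarrow> p - p' \<in> uq_ideal q"
proof -
  interpret I: ideal "uq_ideal q" free_ring by (rule ideal_uq_ideal)
  show m: "l * p * r \<in> uq_ideal q" if "p \<in> uq_ideal q" for l p r
    using I.I_l_closed[OF that, of l] I.I_r_closed[of "l * p" r] by (simp add: free_ring_def)
  show a: "p + p' \<in> uq_ideal q" if "p \<in> uq_ideal q" "p' \<in> uq_ideal q" for p p'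
    using additive_subgroup.a_closed[OF ideal.axioms(1)[OF ideal_uq_ideal] that] by (simp add: free_ring_def)
  show "p - p' \<in> uq_ideal q" if "p \<in> uq_ideal q" "p' \<in> uq_ideal q"
    using a[OF that(1) m[OF that(2), of "- 1" 1]] by simp
qed

lemma fgen_fscalar_left_commute: "fgen g * (fscalar c * p) = fscalar c * (fgen g * p)"
  by (simp add: mult.assoc[symmetric] fscalar_fgen_commute)

lemma q_minus_inverse_nonzero:
  fixes q :: "'a::field"
  assumes "q \<noteq> 0" "q^4 \<noteq> 1"
  shows "q - inverse q \<noteq> 0"
proof
  assume "q - inverse q = 0"
  then have "q * q = 1" using assms(1) by (simp add: field_simps)
  then have "q^4 = 1" by (simp add: power4_eq_xxxx mult.assoc)
  with assms(2) show False ..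
qed

text \<open>Multiplying by \<open>q - inverse q\<close> clears the denominator, so that later
  identities can be checked by plain ring normalization.\<close>

lemma q_weyl_cleared_in_ideal:
  fixes q :: "'a::field"
  assumes "q \<noteq> 0" "q^4 \<noteq> 1" "q_weyl q u v \<in> uq_relators q"
  shows "fscalar q * (fgen u * fgen v) - fscalar (inverse q) * (fgen v * fgen u)
    - fscalar (q - inverse q) \<in> uq_ideal q"
proof -
  have "fscalar (q - inverse q) * q_weyl q u v * 1 \<in> uq_ideal q"
    using assms(3) uq_relators_in_ideal by (blast intro: uq_ideal_mult)
  moreover have "fscalar (q - inverse q) * q_weyl q u v * 1 =
      fscalar q * (fgen u * fgen v) - fscalar (inverse q) * (fgen v * fgen u) - fscalar (q - inverse q)"
    using q_minus_inverse_nonzero[OF assms(1,2)]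
    by (simp add: q_weyl_def right_diff_distrib mult.assoc[symmetric] fscalar_mult fscalar_one)
  ultimately show ?thesis by simp
qed

text \<open>Multiplying the relations for \<open>x, y\<close> and \<open>y, z\<close> by
  \<open>y^(-1)\<close> on both sides eliminates \<open>y\<close>. The first three identities
  therefore live in the subalgebra and are available on any of its modules.\<close>

lemma
  fixes q :: "'a::field"
  assumes q: "q \<noteq> 0" "q^4 \<noteq> 1"
  shows uq_yi_x: "uq_scalar q q \<otimes>\<^bsub>uq q\<^esub> (uq_yi q \<otimes>\<^bsub>uq q\<^esub> uq_x q) =
      uq_scalar q (inverse q) \<otimes>\<^bsub>uq q\<^esub> (uq_x q \<otimes>\<^bsub>uq q\<^esub> uq_yi q) \<oplus>\<^bsub>uq q\<^esub>
      uq_scalar q (q - inverse q) \<otimes>\<^bsub>uq q\<^esub> (uq_yi q \<otimes>\<^bsub>uq q\<^esub> uq_yi q)"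
    and uq_z_yi: "uq_scalar q q \<otimes>\<^bsub>uq q\<^esub> (uq_z q \<otimes>\<^bsub>uq q\<^esub> uq_yi q) =
      uq_scalar q (inverse q) \<otimes>\<^bsub>uq q\<^esub> (uq_yi q \<otimes>\<^bsub>uq q\<^esub> uq_z q) \<oplus>\<^bsub>uq q\<^esub>
      uq_scalar q (q - inverse q) \<otimes>\<^bsub>uq q\<^esub> (uq_yi q \<otimes>\<^bsub>uq q\<^esub> uq_yi q)"
    and uq_z_x: "uq_scalar q q \<otimes>\<^bsub>uq q\<^esub> (uq_z q \<otimes>\<^bsub>uq q\<^esub> uq_x q) =
      uq_scalar q (inverse q) \<otimes>\<^bsub>uq q\<^esub> (uq_x q \<otimes>\<^bsub>uq q\<^esub> uq_z q) \<oplus>\<^bsub>uq q\<^esub>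
      uq_scalar q (q - inverse q)"
    and uq_y_yi: "uq_y q \<otimes>\<^bsub>uq q\<^esub> uq_yi q = \<one>\<^bsub>uq q\<^esub>"
    and uq_yi_y: "uq_yi q \<otimes>\<^bsub>uq q\<^esub> uq_y q = \<one>\<^bsub>uq q\<^esub>"
proof -
  let ?x = "fgen Gx :: 'a free_alg" and ?y = "fgen Gy :: 'a free_alg"
    and ?i = "fgen Gyi :: 'a free_alg" and ?z = "fgen Gz :: 'a free_alg"
  let ?r = "?y * ?i - 1" and ?l = "?i * ?y - 1"
  have rel: "?r \<in> uq_ideal q" "?l \<in> uq_ideal q"
    using uq_relators_in_ideal by (auto simp: uq_relators_def)
  let ?W = "\<lambda>u v. fscalar q * (fgen u * fgen v) - fscalar (inverse q) * (fgen v * fgen u)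
    - fscalar (q - inverse q)"
  have W: "?W Gx Gy \<in> uq_ideal q" "?W Gy Gz \<in> uq_ideal q" "?W Gz Gx \<in> uq_ideal q"
    using q_weyl_cleared_in_ideal[OF q] by (auto simp: uq_relators_def)
  note to_class = uq_scalar_def uq_x_def uq_y_def uq_yi_def uq_z_def
    uq_class_add[symmetric] uq_class_mult[symmetric] uq_class_one[symmetric]
  note norm = algebra_simps fgen_fscalar_left_commute fscalar_fgen_commute[symmetric]
  \<comment> \<open>Sandwiching produces the products \<open>?i * ?x * ?y * ?i\<close> and
    \<open>?i * ?y * ?x * ?i\<close>; the terms with \<open>?r\<close> and \<open>?l\<close> cancel
    each \<open>?y\<close> against the adjacent \<open>?i\<close>.\<close>
  have "?i * ?W Gx Gy * ?i - (fscalar q * ?i * ?x) * ?r * 1 + fscalar (inverse q) * ?l * (?x * ?i)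
    \<in> uq_ideal q"
    by (intro uq_ideal_add uq_ideal_diff uq_ideal_mult W rel)
  also have "?i * ?W Gx Gy * ?i - (fscalar q * ?i * ?x) * ?r * 1 + fscalar (inverse q) * ?l * (?x * ?i) =
    fscalar q * (?i * ?x) -
      (fscalar (inverse q) * (?x * ?i) + fscalar (q - inverse q) * (?i * ?i))"
    by (simp add: norm)
  finally show "uq_scalar q q \<otimes>\<^bsub>uq q\<^esub> (uq_yi q \<otimes>\<^bsub>uq q\<^esub> uq_x q) =
      uq_scalar q (inverse q) \<otimes>\<^bsub>uq q\<^esub> (uq_x q \<otimes>\<^bsub>uq q\<^esub> uq_yi q) \<oplus>\<^bsub>uq q\<^esub>
      uq_scalar q (q - inverse q) \<otimes>\<^bsub>uq q\<^esub> (uq_yi q \<otimes>\<^bsub>uq q\<^esub> uq_yi q)"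
    unfolding to_class by (rule uq_class_eqI)
  have "?i * ?W Gy Gz * ?i - fscalar q * ?l * (?z * ?i) + (fscalar (inverse q) * ?i * ?z) * ?r * 1
    \<in> uq_ideal q"
    by (intro uq_ideal_add uq_ideal_diff uq_ideal_mult W rel)
  also have "?i * ?W Gy Gz * ?i - fscalar q * ?l * (?z * ?i) + (fscalar (inverse q) * ?i * ?z) * ?r * 1 =
    fscalar q * (?z * ?i) -
      (fscalar (inverse q) * (?i * ?z) + fscalar (q - inverse q) * (?i * ?i))"
    by (simp add: norm)
  finally show "uq_scalar q q \<otimes>\<^bsub>uq q\<^esub> (uq_z q \<otimes>\<^bsub>uq q\<^esub> uq_yi q) =
      uq_scalar q (inverse q) \<otimes>\<^bsub>uq q\<^esub> (uq_yi q \<otimes>\<^bsub>uq q\<^esub> uq_z q) \<oplus>\<^bsub>uq q\<^esub>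
      uq_scalar q (q - inverse q) \<otimes>\<^bsub>uq q\<^esub> (uq_yi q \<otimes>\<^bsub>uq q\<^esub> uq_yi q)"
    unfolding to_class by (rule uq_class_eqI)
  show "uq_scalar q q \<otimes>\<^bsub>uq q\<^esub> (uq_z q \<otimes>\<^bsub>uq q\<^esub> uq_x q) =
      uq_scalar q (inverse q) \<otimes>\<^bsub>uq q\<^esub> (uq_x q \<otimes>\<^bsub>uq q\<^esub> uq_z q) \<oplus>\<^bsub>uq q\<^esub>
      uq_scalar q (q - inverse q)"
    unfolding to_class using W(3) by (intro uq_class_eqI) (simp add: diff_diff_eq)
  show "uq_y q \<otimes>\<^bsub>uq q\<^esub> uq_yi q = \<one>\<^bsub>uq q\<^esub>" "uq_yi q \<otimes>\<^bsub>uq q\<^esub> uq_y q = \<one>\<^bsub>uq q\<^esub>"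
    unfolding to_class by (rule uq_class_eqI[OF rel(1)], rule uq_class_eqI[OF rel(2)])
qed

lemma uq_scalar_commute:
  assumes "u \<in> {uq_x q, uq_y q, uq_yi q, uq_z q}"
  shows "uq_scalar q c \<otimes>\<^bsub>uq q\<^esub> u = u \<otimes>\<^bsub>uq q\<^esub> uq_scalar q c"
  using assms
  by (auto simp: uq_scalar_def uq_x_def uq_y_def uq_yi_def uq_z_def fscalar_fgen_commute
      simp flip: uq_class_mult)

text \<open>\<open>algebra_module\<close> speaks of sums and products only, so negatives are handled
  as multiples by the scalar \<open>- 1\<close>.\<close>

lemma uq_a_inv:
  assumes "u \<in> carrier (uq q)"
  shows "\<ominus>\<^bsub>uq q\<^esub> u = uq_scalar q (- 1) \<otimes>\<^bsub>uq q\<^esub> u"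
proof -
  interpret R: ring "uq q" by (rule ring_uq)
  obtain p where u: "u = uq_class q p" using assms by (auto simp: carrier_uq)
  have zero: "uq_class q 0 = \<zero>\<^bsub>uq q\<^esub>"
    using uq_class_diff[of q 0 0] by (simp add: R.r_neg a_minus_def)
  have "fscalar (- 1) * p + p = 0"
    by (simp add: fscalar_def single_uminus)
  then have "uq_scalar q (- 1) \<otimes>\<^bsub>uq q\<^esub> u \<oplus>\<^bsub>uq q\<^esub> u = \<zero>\<^bsub>uq q\<^esub>"
    by (simp add: u uq_scalar_def zero flip: uq_class_mult uq_class_add)
  then show ?thesis
    using assms by (intro R.minus_equality) (simp_all add: uq_scalar_def)
qed

section \<open>Modules over the subalgebra and their extensions\<close>

locale uq_vee_rep = vector_space scale
  for scale :: "'f::field \<Rightarrow> 'v::ab_group_add \<Rightarrow> 'v" +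
  fixes q :: 'f and act :: "'f free_alg set \<Rightarrow> 'v \<Rightarrow> 'v"
  assumes q: "q \<noteq> 0" "q ^ 4 \<noteq> 1"
    and module: "uq_vee_module scale q act"
begin

lemma act_vadd: "u \<in> uq_vee_carrier q \<Longrightarrow> act u (v + w) = act u v + act u w"
  and act_add: "u \<in> uq_vee_carrier q \<Longrightarrow> u' \<in> uq_vee_carrier q \<Longrightarrow>
    act (u \<oplus>\<^bsub>uq q\<^esub> u') v = act u v + act u' v"
  and act_mult: "u \<in> uq_vee_carrier q \<Longrightarrow> u' \<in> uq_vee_carrier q \<Longrightarrow>
    act (u \<otimes>\<^bsub>uq q\<^esub> u') v = act u (act u' v)"
  and act_one: "act \<one>\<^bsub>uq q\<^esub> v = v"
  and act_scalar: "act (uq_scalar q c) v = scale c v"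
  using module by (simp_all add: uq_vee_module_def algebra_module_def uq_vee_def)

lemmas act_simps = act_add act_mult act_one act_scalar uq_vee_carrier_intros

text \<open>Homogeneity is not among the module axioms; it follows because scalars commute with the
  generators.\<close>

lemma linear_act:
  assumes "u \<in> {uq_x q, uq_yi q, uq_z q}"
  shows "Vector_Spaces.linear scale scale (act u)"
proof -
  have u: "u \<in> uq_vee_carrier q" using assms by (auto intro: uq_vee_carrier_intros)
  have "act (uq_scalar q c \<otimes>\<^bsub>uq q\<^esub> u) v = act (u \<otimes>\<^bsub>uq q\<^esub> uq_scalar q c) v" for c v
    using assms by (subst uq_scalar_commute) auto
  then have "act u (scale c v) = scale c (act u v)" for c v
    using u by (simp add: act_simps)
  then show ?thesis
    using act_vadd[OF u] by (simp add: Vector_Spaces.linear_iff vector_space_axioms)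
qed

lemma act_yi_x:
  "scale q (act (uq_yi q) (act (uq_x q) v)) =
    scale (inverse q) (act (uq_x q) (act (uq_yi q) v)) +
    scale (q - inverse q) (act (uq_yi q) (act (uq_yi q) v))"
  using arg_cong[OF uq_yi_x[OF q], of "\<lambda>u. act u v"] by (simp add: act_simps)

lemma act_z_yi:
  "scale q (act (uq_z q) (act (uq_yi q) v)) =
    scale (inverse q) (act (uq_yi q) (act (uq_z q) v)) +
    scale (q - inverse q) (act (uq_yi q) (act (uq_yi q) v))"
  using arg_cong[OF uq_z_yi[OF q], of "\<lambda>u. act u v"] by (simp add: act_simps)

lemma act_z_x:
  "scale q (act (uq_z q) (act (uq_x q) v)) =
    scale (inverse q) (act (uq_x q) (act (uq_z q) v)) + scale (q - inverse q) v"
  using arg_cong[OF uq_z_x[OF q], of "\<lambda>u. act u v"] by (simp add: act_simps)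

lemma act_X:
  "act (uq_X q a) v = scale (inverse (a^2)) (act (uq_x q) v) + scale (1 - inverse (a^2)) (act (uq_yi q) v)"
  by (simp add: uq_X_def uq_smult_def act_simps)

text \<open>Let \<open>y\<close> act as the inverse of the action of \<open>y^(-1)\<close>. All
  relators then act as zero, so the action descends to the quotient, and induction over the
  generated subring shows that it agrees with \<open>act\<close> there.\<close>

lemma extends_if_bij_yi:
  assumes bij: "bij (act (uq_yi q))"
  shows "\<exists>act'. extends_uq_vee_module scale q act act'"
proof -
  let ?x = "act (uq_x q)" and ?i = "act (uq_yi q)" and ?z = "act (uq_z q)"
  define y where "y = inv_into UNIV ?i"
  define \<rho> where "\<rho> = case_uq_gen ?x y ?i ?z"
  have \<rho>: "\<rho> Gx = ?x" "\<rho> Gy = y" "\<rho> Gyi = ?i" "\<rho> Gz = ?z"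
    by (simp_all add: \<rho>_def)
  have iy: "?i (y v) = v" and yi: "y (?i v) = v" for v
    using bij by (simp_all add: y_def bij_is_surj surj_f_inv_f bij_is_inj)
  interpret i: Vector_Spaces.linear scale scale ?i by (rule linear_act) simp
  have y_eqI: "y v = w" if "v = ?i w" for v w
    using that yi by simp
  have linear_y: "Vector_Spaces.linear scale scale y"
    unfolding Vector_Spaces.linear_iff by (auto intro!: y_eqI simp: vector_space_axioms i.add i.scale iy)
  interpret y: Vector_Spaces.linear scale scale y by (rule linear_y)
  interpret free_alg_rep scale \<rho>
  proof (rule free_alg_rep.intro[OF vector_space_axioms], rule free_alg_rep_axioms.intro)
    show "Vector_Spaces.linear scale scale (\<rho> g)" for g
      by (cases g) (auto simp: \<rho> linear_y intro: linear_act)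
  qed
  have h: "q - inverse q \<noteq> 0" by (rule q_minus_inverse_nonzero[OF q])
  have weyl: "rep (q_weyl q u v) w = 0"
    if "scale q (\<rho> u (\<rho> v w)) = scale (inverse q) (\<rho> v (\<rho> u w)) + scale (q - inverse q) w" for u v w
    using that h
    by (simp add: q_weyl_def rep_diff rep_mult rep_fscalar rep_fgen rep_one mult.assoc)
  \<comment> \<open>Evaluating the relation for \<open>y^(-1)\<close> at \<open>y w\<close> and then
    applying \<open>y\<close> undoes the two-sided multiplication by \<open>y^(-1)\<close>.\<close>
  have xy: "scale q (?x (y w)) = scale (inverse q) (y (?x w)) + scale (q - inverse q) w" for w
    using arg_cong[OF act_yi_x[of "y w"], of y] by (simp add: iy yi y.add y.scale)
  have yz: "scale q (y (?z w)) = scale (inverse q) (?z (y w)) + scale (q - inverse q) w" for w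
    using arg_cong[OF act_z_yi[of "y w"], of y] by (simp add: iy yi y.add y.scale)
  interpret uq_rep scale \<rho> q
  proof
    show "rep p v = 0" if "p \<in> uq_relators q" for p v
      using that unfolding uq_relators_def
      by (auto intro!: weyl simp: \<rho> xy yz act_z_x rep_diff rep_mult rep_fgen rep_one iy yi)
  qed
  let ?act = "uq_action scale q \<rho>"
  note um = uq_module_uq_action[unfolded uq_module_def algebra_module_def]
  have "?act u = act u" if "u \<in> uq_vee_carrier q" for u
    using that unfolding uq_vee_carrier_def
  proof (induction rule: generate_ring.induct)
    case one
    show ?case using um by (auto simp: act_one)
  next
    case (incl u)
    have "?act (uq_scalar q c) = act (uq_scalar q c)" for c
      using um by (auto simp: act_scalar)
    then show ?case
      using incl
      by (auto simp: uq_x_def uq_yi_def uq_z_def uq_action_class fun_eq_iff rep_fgen \<rho>)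
  next
    case (a_inv u)
    then have u: "u \<in> uq_vee_carrier q" by (simp add: uq_vee_carrier_def)
    then have c: "u \<in> carrier (uq q)" using uq_vee_carrier_subset by blast
    have "uq_scalar q (- 1) \<in> carrier (uq q)" by (simp add: uq_scalar_def)
    then have "?act (uq_scalar q (- 1) \<otimes>\<^bsub>uq q\<^esub> u) = act (uq_scalar q (- 1) \<otimes>\<^bsub>uq q\<^esub> u)"
      using um c u a_inv.IH by (auto simp: act_simps)
    then show ?case using uq_a_inv[OF c] by simp
  next
    case (eng_add u u')
    then have u: "u \<in> uq_vee_carrier q" "u' \<in> uq_vee_carrier q" by (simp_all add: uq_vee_carrier_def)
    then have "u \<in> carrier (uq q)" "u' \<in> carrier (uq q)" using uq_vee_carrier_subset by blast+
    then show ?case using um u eng_add.IH by (auto simp: act_simps)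
  next
    case (eng_mult u u')
    then have u: "u \<in> uq_vee_carrier q" "u' \<in> uq_vee_carrier q" by (simp_all add: uq_vee_carrier_def)
    then have "u \<in> carrier (uq q)" "u' \<in> carrier (uq q)" using uq_vee_carrier_subset by blast+
    then show ?case using um u eng_mult.IH by (auto simp: act_simps)
  qed
  then show ?thesis
    using uq_module_uq_action by (auto simp: extends_uq_vee_module_def uq_vee_def)
qed

text \<open>In the form \<open>inverse q * (1 - y x)\<close> of \<open>\<nu>_z\<close>, left
  multiplication by \<open>y^(-1)\<close> removes \<open>y\<close>. Hence the right-hand side
  involves \<open>act\<close> only and is the same for every extension.\<close>

lemma extension_nu_z:
  assumes ext: "extends_uq_vee_module scale q act act'"
  shows "act (uq_yi q) (act' (uq_nu_z q) v) =
    scale (inverse q) (act (uq_yi q) v - act (uq_x q) v)"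
proof -
  interpret R: ring "uq q" by (rule ring_uq)
  have um: "uq_module scale q act'" using ext by (simp add: extends_uq_vee_module_def)
  have closed [simp]: "uq_scalar q c \<in> carrier (uq q)" "uq_x q \<in> carrier (uq q)"
    "uq_y q \<in> carrier (uq q)" "uq_yi q \<in> carrier (uq q)" for c
    by (simp_all add: uq_scalar_def uq_x_def uq_y_def uq_yi_def)
  have agree: "act' (uq_yi q) = act (uq_yi q)" "act' (uq_x q) = act (uq_x q)"
    using ext by (simp_all add: extends_uq_vee_module_def uq_vee_def uq_vee_carrier_intros)
  interpret i: Vector_Spaces.linear scale scale "act (uq_yi q)" by (rule linear_act) simp
  have add: "act' (u \<oplus>\<^bsub>uq q\<^esub> u') v = act' u v + act' u' v"
    and mult: "act' (u \<otimes>\<^bsub>uq q\<^esub> u') v = act' u (act' u' v)"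
    if "u \<in> carrier (uq q)" "u' \<in> carrier (uq q)" for u u' v
    using um that by (simp_all add: uq_module_def algebra_module_def)
  have one: "act' \<one>\<^bsub>uq q\<^esub> v = v" and scalar: "act' (uq_scalar q c) v = scale c v" for c v
    using um by (simp_all add: uq_module_def algebra_module_def)
  have "act' (uq_nu_z q) v = scale (inverse q) (v - act' (uq_y q) (act (uq_x q) v))"
    by (simp add: uq_nu_z_alt[OF q] uq_smult_def a_minus_def uq_a_inv add mult one scalar agree)
  moreover have "act (uq_yi q) (act' (uq_y q) w) = w" for w
    using arg_cong[OF uq_yi_y[OF q], of "\<lambda>u. act' u w"] by (simp add: mult one agree)
  ultimately show ?thesis by (simp add: i.scale i.diff)
qed

end

section \<open>Invertibility of the action of \<open>y\<^sup>-\<^sup>1\<close>\<close>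

text \<open>A common eigenvector spans an invariant line, which is everything by irreducibility.
  Then \<open>A\<close> is a scalar with a single eigenspace, contradicting
  \<open>d \<ge> 1\<close>.\<close>

lemma (in vector_space) tridiagonal_no_common_eigenvector:
  assumes tp: "tridiagonal_pair scale A As" and ord: "tridiagonal_ordering scale A As d V" and d: "d \<ge> 1"
    and u: "A u = scale s u" "As u = scale t u"
  shows "u = 0"
proof (rule ccontr)
  assume "u \<noteq> 0"
  have lin: "Vector_Spaces.linear scale scale A" "Vector_Spaces.linear scale scale As"
    and irr: "\<And>W. subspace W \<Longrightarrow> A ` W \<subseteq> W \<Longrightarrow> As ` W \<subseteq> W \<Longrightarrow> W \<noteq> {0} \<Longrightarrow> W = UNIV"
    using tp unfolding tridiagonal_pair_def by (blast, blast, metis)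
  interpret A: Vector_Spaces.linear scale scale A by (rule lin)
  interpret As: Vector_Spaces.linear scale scale As by (rule lin)
  have "span {u} = UNIV"
  proof (rule irr)
    show "A ` span {u} \<subseteq> span {u}" "As ` span {u} \<subseteq> span {u}"
      by (auto simp: span_singleton A.scale As.scale u mult.commute)
    show "span {u} \<noteq> {0}" using \<open>u \<noteq> 0\<close> span_base[of u "{u}"] by auto
  qed simp
  then have all: "A v = scale s v" for v
  proof -
    from \<open>span {u} = UNIV\<close> obtain k where "v = scale k u" by (auto simp: span_singleton)
    then show ?thesis by (simp add: A.scale u mult.commute)
  qed
  have "E = UNIV" if "E \<in> eigenspaces scale A" for E
  proof -
    from that obtain k where E: "E = eigenspace scale A k" "E \<noteq> {0}" by (auto simp: eigenspaces_def)
    have "0 \<in> E" using subspace_eigenspace[OF lin(1)] E(1) by (simp add: subspace_0)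
    with E obtain v where v: "v \<in> E" "v \<noteq> 0" by blast
    then have "scale k v = scale s v" using E(1) all by (simp add: eigenspace_def)
    then have "k = s" using v by simp
    then show ?thesis using E all by (auto simp: eigenspace_def)
  qed
  moreover have "V 0 \<in> eigenspaces scale A" "V d \<in> eigenspaces scale A"
    using ord by (auto simp: tridiagonal_ordering_def bij_betw_def)
  ultimately have "V 0 = V d" by metis
  then have "0 = d" using ord by (auto simp: tridiagonal_ordering_def bij_betw_def dest: inj_onD)
  then show False using d by simp
qed

text \<open>The hypothesis says that \<open>a * x\<close> and \<open>a * y\<close> are mutually
  inverse, so the two summands merely change places.\<close>

lemma q_Racah_eigenvalue_diff:
  fixes a x y :: "'f::field"
  assumes "a \<noteq> 0" "x \<noteq> 0" "y \<noteq> 0" "a\<^sup>2 * (x * y) = 1"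
  shows "a * x + inverse a * inverse x = a * y + inverse a * inverse y"
proof -
  have "inverse a * inverse x = a * y" "inverse a * inverse y = a * x"
    using assms by (simp_all add: field_simps power2_eq_square)
  then show ?thesis by simp
qed

text \<open>Both claims express that the \<open>\<theta> i\<close> are distinct: equal powers of
  \<open>q\<close> give equal eigenvalues, and an excluded value of \<open>a\<^sup>2\<close> makes
  \<open>\<theta> i = \<theta> j\<close> for some distinct \<open>i, j\<close> with
  \<open>i + j = k + d\<close>.\<close>

lemma
  fixes q a :: "'f::field"
  assumes q: "q \<noteq> 0" and a: "a \<noteq> 0"
    and inj: "inj_on \<theta> {0..d}"
    and \<theta>: "\<forall>i\<le>d. \<theta> i = a * q powi (int d - 2 * int i) + inverse a * q powi (2 * int i - int d)"
  shows q_Racah_inj_on: "inj_on (\<lambda>i. q powi (2 * int i - int d)) {0..d}"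
    and q_Racah_parameter: "\<bar>k\<bar> < int d \<Longrightarrow> a\<^sup>2 \<noteq> q powi (2 * k)"
proof -
  have inv: "q powi (2 * int i - int d) = inverse (q powi (int d - 2 * int i))" for i
    by (simp flip: power_int_minus)
  show "inj_on (\<lambda>i. q powi (2 * int i - int d)) {0..d}"
  proof (rule inj_onI)
    fix i j assume ij: "i \<in> {0..d}" "j \<in> {0..d}" "q powi (2 * int i - int d) = q powi (2 * int j - int d)"
    then have "q powi (int d - 2 * int i) = q powi (int d - 2 * int j)"
      by (simp add: inv)
    then have "\<theta> i = \<theta> j" using ij \<theta> by simp
    then show "i = j" using inj ij by (auto dest: inj_onD)
  qed
  show "a\<^sup>2 \<noteq> q powi (2 * k)" if k: "\<bar>k\<bar> < int d"
  proof
    assume a2: "a\<^sup>2 = q powi (2 * k)"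
    \<comment> \<open>Since \<open>k + d\<close> lies strictly between \<open>0\<close> and
      \<open>2 d\<close>, it is a sum of two distinct indices: \<open>k + d\<close> and
      \<open>0\<close> if \<open>k \<le> 0\<close>, otherwise \<open>d\<close> and
      \<open>k\<close>.\<close>
    obtain i j where ij: "i \<le> d" "j \<le> d" "i \<noteq> j" "int i + int j = k + int d"
    proof (cases "k \<le> 0")
      case True
      show ?thesis by (rule that[of "nat (k + int d)" 0]) (use k True in auto)
    next
      case False
      show ?thesis by (rule that[of d "nat k"]) (use k False in auto)
    qed
    have "2 * k + ((int d - 2 * int i) + (int d - 2 * int j)) = 0"
      using ij(4) by simp
    then have "a\<^sup>2 * (q powi (int d - 2 * int i) * q powi (int d - 2 * int j)) = 1"
      using q a2 by (metis power_int_add power_int_0_right)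
    then have "\<theta> i = \<theta> j"
      using q_Racah_eigenvalue_diff[OF a, of "q powi (int d - 2 * int i)" "q powi (int d - 2 * int j)"]
        \<theta> ij q by (simp add: inv)
    then show False using inj ij by (auto dest: inj_onD)
  qed
qed

text \<open>At either end one of the two intersected sums has a single term.\<close>

lemma (in vector_space) split_U_ends:
  assumes "\<And>i. i \<le> d \<Longrightarrow> subspace (V i)" "\<And>i. i \<le> d \<Longrightarrow> subspace (Vs i)"
  shows "split_U scale d V Vs 0 \<subseteq> Vs 0" "split_U scale d V Vs d \<subseteq> V d"
  using assms(1)[of d] assms(2)[of 0]
  by (auto simp: split_U_def subspace_sum_def span_eq_iff[THEN iffD2])

text \<open>Applied to \<open>N = ker Y\<close>.  A nonzero \<open>N\<close> contains a common eigenvector of \<open>x\<close> and \<open>X\<close> whose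
  eigenvalues differ by the factor \<open>a\<^sup>-\<^sup>2\<close>; by \<open>q_Racah_parameter\<close> it must lie in opposite ends of the
  two split decompositions, and these consist of eigenvectors of \<open>A\<close> or \<open>A\<^sup>*\<close>.\<close>

lemma (in finite_dimensional_vector_space) split_kernel_trivial:
  fixes q a :: 'a
  assumes q: "q \<noteq> 0" and a: "a \<noteq> 0" and d: "d \<ge> 1"
    and tp: "tridiagonal_pair scale A As"
    and V: "tridiagonal_ordering scale A As d V" "\<And>i. i \<le> d \<Longrightarrow> V i = eigenspace scale A (\<theta> i)"
    and Vs: "tridiagonal_ordering scale As A d Vs" "\<And>i. i \<le> d \<Longrightarrow> Vs i = eigenspace scale As (\<theta>s i)"
    and \<theta>: "\<forall>i\<le>d. \<theta> i = a * q powi (int d - 2 * int i) + inverse a * q powi (2 * int i - int d)"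
    and x: "Vector_Spaces.linear scale scale x"
      "\<And>i v. i \<le> d \<Longrightarrow> v \<in> split_U scale d V Vs i \<Longrightarrow> x v = scale (q powi (2 * int i - int d)) v"
    and X: "Vector_Spaces.linear scale scale X"
      "\<And>i v. i \<le> d \<Longrightarrow> v \<in> split_U_down scale d V Vs i \<Longrightarrow> X v = scale (q powi (2 * int i - int d)) v"
    and N: "subspace N" "x ` N \<subseteq> N" "\<And>v. v \<in> N \<Longrightarrow> X v = scale (inverse (a\<^sup>2)) (x v)"
  shows "N = {0}"
proof (rule ccontr)
  assume "N \<noteq> {0}"
  then obtain w where w: "w \<in> N" "w \<noteq> 0" using subspace_0[OF N(1)] by blast
  have lin: "Vector_Spaces.linear scale scale A" "Vector_Spaces.linear scale scale As"
    using tp by (simp_all add: tridiagonal_pair_def)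
  \<comment> \<open>With the reversed ordering, the second decomposition is \<open>split_U\<close>
    for \<open>V'\<close> and \<open>Vs\<close>.\<close>
  define V' where "V' i = V (d - i)" for i
  have V': "tridiagonal_ordering scale A As d V'" "\<And>i. i \<le> d \<Longrightarrow> V' i = eigenspace scale A (\<theta> (d - i))"
    using tridiagonal_ordering_reverse[OF V(1)] V(2) by (simp_all add: V'_def[abs_def])
  have down: "split_U_down scale d V Vs i = split_U scale d V' Vs i" if "i \<le> d" for i
    using split_U_down_eq_split_U[OF that] by (simp add: V'_def[abs_def])
  have sub: "subspace (V i)" "subspace (V' i)" "subspace (Vs i)" if "i \<le> d" for i
    using that V(2) V'(2) Vs(2) subspace_eigenspace lin by simp_all
  have inj: "inj_on \<theta> {0..d}"
    using V unfolding tridiagonal_ordering_def bij_betw_def by (auto simp: inj_on_def)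
  note inj_x = q_Racah_inj_on[OF q a inj \<theta>]
  obtain i u where i: "i \<le> d" and u: "u \<in> N" "u \<in> split_U scale d V Vs i" "u \<noteq> 0"
    using invariant_subspace_meets_eigenspace[OF x(1) N(1,2) _ inj_x, of "split_U scale d V Vs" w]
      w x(2) subspace_split_U split_decomposition[OF tp V Vs] by fastforce
  have "X u = scale (inverse (a\<^sup>2) * q powi (2 * int i - int d)) u"
    using N(3) u x(2)[OF i] by simp
  then obtain j where j: "j \<le> d" "u \<in> split_U scale d V' Vs j"
    and eq: "inverse (a\<^sup>2) * q powi (2 * int i - int d) = q powi (2 * int j - int d)"
    using eigenvector_in_eigenspace_family[OF X(1) _ inj_x, of "split_U scale d V' Vs" u]
      X(2) down subspace_split_U split_decomposition[OF tp V' Vs] u(3) by fastforce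
  have "2 * (int i - int j) + (2 * int j - int d) = 2 * int i - int d" by simp
  then have "q powi (2 * (int i - int j)) * q powi (2 * int j - int d) = q powi (2 * int i - int d)"
    using q by (metis power_int_add)
  also have "\<dots> = a\<^sup>2 * q powi (2 * int j - int d)"
    unfolding eq[symmetric] using a by simp
  finally have "a\<^sup>2 = q powi (2 * (int i - int j))" using q by simp
  then have "\<not> \<bar>int i - int j\<bar> < int d" using q_Racah_parameter[OF q a inj \<theta>] by blast
  \<comment> \<open>If \<open>i = d\<close> and \<open>j = 0\<close>, then \<open>u\<close> lies in
    \<open>V d\<close> and in \<open>Vs 0\<close>; if \<open>i = 0\<close> and \<open>j = d\<close>,
    it lies in \<open>Vs 0\<close> and in \<open>V' d\<close>, which is \<open>V 0\<close>.\<close>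
  then consider "i = d" "j = 0" | "i = 0" "j = d" using i j(1) by linarith
  then have "(u \<in> V d \<or> u \<in> V 0) \<and> u \<in> Vs 0"
  proof cases
    case 1
    then show ?thesis
      using u(2) j(2) split_U_ends[of d V Vs] split_U_ends[of d V' Vs] sub by blast
  next
    case 2
    then show ?thesis
      using u(2) j(2) split_U_ends[of d V Vs] split_U_ends[of d V' Vs] sub by (auto simp: V'_def)
  qed
  then obtain s t where "A u = scale s u" "As u = scale t u"
    using V(2)[of d] V(2)[of 0] Vs(2)[of 0] by (auto simp: eigenspace_def)
  then show False using tridiagonal_no_common_eigenvector[OF tp V(1) d] u(3) by blast
qed

section \<open>The Bockting operator and the action of \<open>\<nu>_z\<close>\<close>

theorem proposition12p17:
  fixes scale :: "'f::field \<Rightarrow> 'v::ab_group_add \<Rightarrow> 'v"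
    and q a b :: 'f
    and A As K B :: "'v \<Rightarrow> 'v"
    and d :: nat
    and V Vs :: "nat \<Rightarrow> 'v set"
    and \<theta> \<theta>s :: "nat \<Rightarrow> 'f"
    and act :: "'f free_alg set \<Rightarrow> 'v \<Rightarrow> 'v"
  assumes "q \<noteq> 0" and "q ^ 4 \<noteq> 1"
    and "tridiagonal_pair scale A As"
    and "d \<ge> 1"
    and "tridiagonal_ordering scale A As d V"
    and "tridiagonal_ordering scale As A d Vs"
    and "\<forall>i\<le>d. V i = eigenspace scale A (\<theta> i)"
    and "\<forall>i\<le>d. Vs i = eigenspace scale As (\<theta>s i)"
    and "a \<noteq> 0" and "b \<noteq> 0"
    and "\<forall>i\<le>d. \<theta> i = a * q powi (int d - 2 * int i) + inverse a * q powi (2 * int i - int d)"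
    and "\<forall>i\<le>d. \<theta>s i = b * q powi (int d - 2 * int i) + inverse b * q powi (2 * int i - int d)"
    and "Vector_Spaces.linear scale scale K"
    and "\<forall>i\<le>d. \<forall>v\<in>split_U scale d V Vs i. K v = scale (q powi (int d - 2 * int i)) v"
    and "Vector_Spaces.linear scale scale B"
    and "\<forall>i\<le>d. \<forall>v\<in>split_U_down scale d V Vs i. B v = scale (q powi (int d - 2 * int i)) v"
    and "uq_vee_module scale q act"
    and "act (uq_x q) = inv_into UNIV K"
    and "act (uq_X q a) = inv_into UNIV B"
    and "act (uq_A q a) = A"
  shows "(\<exists>act'. extends_uq_vee_module scale q act act') \<and>
         (\<forall>act'. extends_uq_vee_module scale q act act' \<longrightarrow>
            act' (uq_nu_z q) = (\<lambda>v. scale a (bockting scale q a K B v)))"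
proof -
  note q = assms(1,2) and tp = assms(3) and d = assms(4) and ord = assms(5,6)
  note a = assms(9) and \<theta> = assms(11) and K = assms(13,14) and B = assms(15,16)
  have Veig: "\<And>i. i \<le> d \<Longrightarrow> V i = eigenspace scale A (\<theta> i)"
    and Vseig: "\<And>i. i \<le> d \<Longrightarrow> Vs i = eigenspace scale As (\<theta>s i)"
    using assms(7,8) by auto
  obtain Basis where "finite_dimensional_vector_space scale Basis"
    using tp by (auto simp: tridiagonal_pair_def)
  then interpret finite_dimensional_vector_space scale Basis .
  interpret uq_vee_rep scale q act
    by (rule uq_vee_rep.intro[OF vector_space_axioms], rule uq_vee_rep_axioms.intro)
      (use q assms(17) in auto)
  interpret B: Vector_Spaces.linear scale scale B by (rule B(1))
  have inv_q: "inverse (q powi (int d - 2 * int i)) = q powi (2 * int i - int d)" for i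
    by (simp flip: power_int_minus)
  have span_U: "span (\<Union>i\<in>{0..d}. split_U scale d V Vs i) = UNIV"
    by (rule split_decomposition[OF tp ord(1) Veig ord(2) Vseig])
  have "span (\<Union>i\<in>{0..d}. split_U scale d (\<lambda>j. V (d - j)) Vs i) = UNIV"
    by (rule split_decomposition[OF tp tridiagonal_ordering_reverse[OF ord(1)], where \<theta> = "\<lambda>j. \<theta> (d - j)"])
      (use Veig ord(2) Vseig in auto)
  then have span_down: "span (\<Union>i\<in>{0..d}. split_U_down scale d V Vs i) = UNIV"
    by (simp add: split_U_down_eq_split_U)
  define x where "x = act (uq_x q)"
  define Y where "Y = act (uq_yi q)"
  define X where "X = act (uq_X q a)"
  interpret x: Vector_Spaces.linear scale scale x unfolding x_def by (rule linear_act) simp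
  interpret Y: Vector_Spaces.linear scale scale Y unfolding Y_def by (rule linear_act) simp
  have X: "X v = scale (inverse (a\<^sup>2)) (x v) + scale (1 - inverse (a\<^sup>2)) (Y v)" for v
    by (simp add: X_def x_def Y_def act_X)
  have "Vector_Spaces.linear scale scale X"
    by unfold_locales (simp_all add: X x.add x.scale Y.add Y.scale algebra_simps)
  then interpret X: Vector_Spaces.linear scale scale X .
  have bijB: "bij B"
    by (rule bij_of_spanning_eigenvectors[OF B(1) _ _ span_down, where c = "\<lambda>i. q powi (int d - 2 * int i)"])
      (use B(2) q in auto)
  have x_eig: "x v = scale (q powi (2 * int i - int d)) v"
    if "i \<le> d" "v \<in> split_U scale d V Vs i" for i v
    unfolding x_def assms(18) inv_q[symmetric]
    by (rule bij_of_spanning_eigenvectors(2)[OF K(1) _ _ span_U]) (use K(2) q that in auto)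
  have X_eig: "X v = scale (q powi (2 * int i - int d)) v"
    if "i \<le> d" "v \<in> split_U_down scale d V Vs i" for i v
    unfolding X_def assms(19) inv_q[symmetric]
    by (rule bij_of_spanning_eigenvectors(2)[OF B(1) _ _ span_down]) (use B(2) q that in auto)
  have "{v. Y v = 0} = {0}"
  proof (rule split_kernel_trivial[OF q(1) a d tp ord(1) Veig ord(2) Vseig \<theta> x.linear_axioms x_eig
        X.linear_axioms X_eig])
    show "subspace {v. Y v = 0}" by (rule Y.subspace_kernel)
    show "x ` {v. Y v = 0} \<subseteq> {v. Y v = 0}"
    proof clarify
      \<comment> \<open>Both terms on the right of \<open>act_yi_x\<close> contain
        \<open>Y v\<close>, so only \<open>q Y (x v) = 0\<close> remains.\<close>
      fix v assume "Y v = 0"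
      then have "scale q (Y (x v)) = 0"
        using act_yi_x[of v] by (simp add: x.zero Y.zero flip: x_def Y_def)
      then show "Y (x v) = 0" using q(1) by simp
    qed
  qed (auto simp: X)
  then have "inj Y" by (subst Y.inj_iff_eq_0) auto
  then have bijY: "bij Y" using linear_inj_imp_surj[OF Y.linear_axioms] by (simp add: bij_def)
  \<comment> \<open>This is the excluded value for \<open>k = 0\<close>, which is in range because
    \<open>d \<ge> 1\<close>.\<close>
  have "a\<^sup>2 \<noteq> 1"
  proof -
    have "inj_on \<theta> {0..d}"
      using ord(1) Veig unfolding tridiagonal_ordering_def bij_betw_def by (auto simp: inj_on_def)
    from q_Racah_parameter[OF q(1) a this \<theta>, of 0] show ?thesis using d by simp
  qed
  then have a2: "a - inverse a \<noteq> 0" using a by (simp add: field_simps power2_eq_square)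
  define T where "T = B \<circ> inv_into UNIV K"
  have T: "T v = B (x v)" for v by (simp add: T_def x_def assms(18))
  have "B (X v) = v" for v using bijB by (simp add: X_def assms(19) bij_is_surj surj_f_inv_f)
  \<comment> \<open>Apply \<open>B\<close> to the formula for \<open>X\<close>: on the left
    \<open>B X\<close> is the identity, on the right \<open>B x\<close> is \<open>T\<close>.\<close>
  then have BX: "v = scale (inverse (a\<^sup>2)) (T v) + scale (1 - inverse (a\<^sup>2)) (B (Y v))" for v
    by (simp add: X T B.add B.scale)
  define S where "S v = scale a v - scale (inverse a) (T v)" for v
  \<comment> \<open>Multiplying \<open>BX\<close> by \<open>a\<close> turns its coefficients into
    \<open>inverse a\<close> and \<open>a - inverse a\<close>; the \<open>T\<close> term then
    cancels in \<open>S\<close>.\<close>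
  have S: "S v = scale (a - inverse a) (B (Y v))" for v
  proof -
    have "scale a v = scale a (scale (inverse (a\<^sup>2)) (T v) + scale (1 - inverse (a\<^sup>2)) (B (Y v)))"
      using BX[of v] by simp
    also have "\<dots> = scale (inverse a) (T v) + scale (a - inverse a) (B (Y v))"
      using a by (simp add: scale_right_distrib right_diff_distrib power2_eq_square mult.assoc[symmetric])
    finally show ?thesis by (simp add: S_def)
  qed
  \<comment> \<open>This makes \<open>inv_into UNIV S\<close> in \<open>bockting\<close> a genuine
    inverse.\<close>
  have "bij S"
  proof -
    have "bij (\<lambda>v. scale (a - inverse a) v)"
      by (rule bij_betw_byWitness[where f' = "scale (inverse (a - inverse a))"]) (use a2 in auto)
    then have "bij (scale (a - inverse a) \<circ> (B \<circ> Y))" using bijB bijY by (intro bij_comp)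
    moreover have "S = scale (a - inverse a) \<circ> (B \<circ> Y)" by (auto simp: S)
    ultimately show ?thesis by simp
  qed
  have nu: "act' (uq_nu_z q) = (\<lambda>v. scale a (bockting scale q a K B v))"
    if ext: "extends_uq_vee_module scale q act act'" for act'
  proof
    fix v
    define w where "w = inv_into UNIV S v"
    have w: "S w = v" using \<open>bij S\<close> by (simp add: w_def bij_is_surj surj_f_inv_f)
    have psi: "bockting scale q a K B v = scale (inverse q) (w - T w)"
      by (simp add: bockting_def w_def S_def[abs_def] flip: T_def)
    \<comment> \<open>\<open>S\<close> is a linear combination of the identity and \<open>T\<close>,
      hence commutes with \<open>T\<close>.\<close>
    have TS: "S (T w) = T v"
      unfolding w[symmetric] by (simp add: S_def T x.diff x.scale B.diff B.scale)
    \<comment> \<open>Since \<open>w\<close> is the preimage of \<open>v\<close> under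
      \<open>S\<close>, this evaluates \<open>B Y\<close> on \<open>a (w - T w)\<close> without
      inverting anything; cancelling the scalar and then \<open>B\<close> leaves
      \<open>Y v - x v\<close>, which \<open>extension_nu_z\<close> matches with
      \<open>\<nu>_z\<close> up to the factor \<open>inverse q\<close>.\<close>
    have "scale (a - inverse a) (B (Y (scale a (w - T w)))) = S (scale a w) - S (scale a (T w))"
      by (simp add: S Y.diff Y.scale B.diff B.scale scale_right_diff_distrib)
    also have "\<dots> = scale a (v - T v)"
      by (simp add: S_def scale_right_diff_distrib flip: TS w)
        (simp add: S_def T x.diff x.scale B.diff B.scale algebra_simps)
    also have "\<dots> = S v - scale (a - inverse a) (T v)"
      by (simp add: S_def algebra_simps)
    also have "\<dots> = scale (a - inverse a) (B (Y v - x v))"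
      by (simp add: S T B.diff scale_right_diff_distrib)
    finally have "B (Y (scale a (w - T w))) = B (Y v - x v)" using a2 by simp
    then have "Y (scale a (w - T w)) = Y v - x v" using bijB by (simp add: bij_def inj_eq)
    then have "Y (scale (inverse q) (scale a (w - T w))) = Y (act' (uq_nu_z q) v)"
      using extension_nu_z[OF ext, of v, folded x_def Y_def] by (simp only: Y.scale)
    then have "scale (inverse q) (scale a (w - T w)) = act' (uq_nu_z q) v"
      using \<open>inj Y\<close> by (simp add: inj_eq)
    then show "act' (uq_nu_z q) v = scale a (bockting scale q a K B v)"
      by (simp add: psi mult.commute)
  qed
  show ?thesis using extends_if_bij_yi bijY nu by (simp add: Y_def)
qed

end
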